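(* For every $\epsilon>0$ there is a non-clairvoyant online algorithm for minimizing total weighted flow-time on unrelated machines that is $(1+\epsilon)$-speed $O(1/\epsilon^2)$-competitive. Furthermore, in this algorithm each job migrates at most $O((\log W+\log n)/\epsilon)$ times, where $n$ is the number of jobs and $W$ is the ratio of the maximum job weight to the minimum job weight.
   Context: Problem (online non-clairvoyant weighted flow-time on unrelated machines): there are $m$ machines and jobs arriving over time. Job $j$ has release time $r_j$, weight $w_j>0$, processing length $p_j>0$, and for each machine $i$ a rate $\ell_{ij}\ge 0$. At each time instant each alive job is assigned to at most one machine; machine $i$ divides its processing power among the jobs $J_i(t)$ assigned to it, giving job $j$ a share $\nu_j(t)\ge 0$ with $\sum_{j\in J_i(t)}\nu_j(t)\le 1$, and job $j$ is then processed at rate $\ell_{ij}\nu_j(t)$. Preemption and migration between machines are allowed at any time at no cost. Job $j$ completes at the earliest time $C_j$ with $\int_{r_j}^{C_j}(\text{rate of }j)\,dt\ge p_j$; its flow-time is $F_j=C_j-r_j$, and the objective is $\sum_j w_jF_j$. The online algorithm learns $w_j$ and all $\ell_{ij}$ at time $r_j$ but never learns $p_j$ (it only learns that $j$ has completed when it does). An algorithm is $s$-speed $c$-competitive if, when each machine's total power is $s$ instead of $1$ (i.e. shares satisfy $\sum_{j\in J_i(t)}\nu_j(t)\le s$), its objective is at most $c$ times the optimal objective of an offline schedule (knowing all jobs in advance) run with speed $1$, on every instance. *)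

theory Defs
  imports "HOL-Analysis.Analysis" "HOL-Library.Landau_Symbols"
begin

text \<open>Machines are \<open>0, ..., m - 1\<close>. Jobs form an arbitrary finite set of names, not an initial
  segment of the naturals and not ordered by release time, so that the names of the jobs released
  so far tell nothing about the jobs still to come.\<close>

record sched_instance =
  machines :: nat
  jobs :: "nat set"
  release :: "nat \<Rightarrow> real"
  weight :: "nat \<Rightarrow> real"
  len :: "nat \<Rightarrow> real"
  rate :: "nat \<Rightarrow> nat \<Rightarrow> real"  \<comment> \<open>\<open>rate I i j\<close>: machine \<open>i\<close>, job \<open>j\<close>\<close>

definition valid_instance :: "sched_instance \<Rightarrow> bool" where
  "valid_instance I \<longleftrightarrow>
     0 < machines I \<and> finite (jobs I) \<and> jobs I \<noteq> {} \<and>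
     (\<forall>j\<in>jobs I. 0 < weight I j \<and> 0 < len I j \<and> (\<forall>i<machines I. 0 \<le> rate I i j))"

definition num_jobs :: "sched_instance \<Rightarrow> nat" where
  "num_jobs I = card (jobs I)"

definition weight_ratio :: "sched_instance \<Rightarrow> real" where
  "weight_ratio I = Max (weight I ` jobs I) / Min (weight I ` jobs I)"

text \<open>A decision maps a job to \<open>Some (i, \<nu>)\<close> if the job is assigned to machine \<open>i\<close> with share
  \<open>\<nu>\<close> of its power, and to \<open>None\<close> if it is assigned to no machine.\<close>

type_synonym decision = "nat \<Rightarrow> (nat \<times> real) option"
type_synonym schedule = "real \<Rightarrow> decision"

definition machine_of :: "schedule \<Rightarrow> nat \<Rightarrow> real \<Rightarrow> nat option" where
  "machine_of \<sigma> j t = map_option fst (\<sigma> t j)"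

definition share_of :: "schedule \<Rightarrow> nat \<Rightarrow> real \<Rightarrow> real" where
  "share_of \<sigma> j t = (case \<sigma> t j of None \<Rightarrow> 0 | Some (i, \<nu>) \<Rightarrow> \<nu>)"

definition proc_rate :: "sched_instance \<Rightarrow> schedule \<Rightarrow> nat \<Rightarrow> real \<Rightarrow> real" where
  "proc_rate I \<sigma> j t = (case \<sigma> t j of None \<Rightarrow> 0 | Some (i, \<nu>) \<Rightarrow> rate I i j * \<nu>)"

text \<open>The infimum is \<open>\<infinity>\<close> if the job never completes.\<close>

definition completion :: "sched_instance \<Rightarrow> schedule \<Rightarrow> nat \<Rightarrow> ereal" where
  "completion I \<sigma> j =
     Inf (ereal ` {T. release I j \<le> T \<and>
                      len I j \<le> integral {release I j..T} (proc_rate I \<sigma> j)})"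

definition flow_time :: "sched_instance \<Rightarrow> schedule \<Rightarrow> nat \<Rightarrow> ereal" where
  "flow_time I \<sigma> j = completion I \<sigma> j - ereal (release I j)"

definition cost :: "sched_instance \<Rightarrow> schedule \<Rightarrow> ereal" where
  "cost I \<sigma> = (\<Sum>j\<in>jobs I. ereal (weight I j) * flow_time I \<sigma> j)"

definition alive :: "sched_instance \<Rightarrow> schedule \<Rightarrow> nat \<Rightarrow> real \<Rightarrow> bool" where
  "alive I \<sigma> j t \<longleftrightarrow>
     j \<in> jobs I \<and> release I j \<le> t \<and> ereal t < completion I \<sigma> j"

definition feasible :: "real \<Rightarrow> sched_instance \<Rightarrow> schedule \<Rightarrow> bool" where
  "feasible s I \<sigma> \<longleftrightarrow>
     (\<forall>t j i \<nu>. \<sigma> t j = Some (i, \<nu>) \<longrightarrow> alive I \<sigma> j t \<and> i < machines I \<and> 0 \<le> \<nu>) \<and>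
     (\<forall>t. \<forall>i<machines I.
        (\<Sum>j | j \<in> jobs I \<and> machine_of \<sigma> j t = Some i. share_of \<sigma> j t) \<le> s) \<and>
     (\<forall>j\<in>jobs I. \<forall>a b. proc_rate I \<sigma> j integrable_on {a..b})"

definition opt :: "sched_instance \<Rightarrow> ereal" where
  "opt I = (INF \<sigma>\<in>{\<sigma>. feasible 1 I \<sigma>}. cost I \<sigma>)"

text \<open>The number of migrations is the largest number of machine changes of the job along an
  increasing sequence of times at which it is assigned. The first assignment is thus no migration,
  and neither is being paused and then resumed on the same machine.\<close>

definition migrations :: "schedule \<Rightarrow> nat \<Rightarrow> enat" where
  "migrations \<sigma> j =
     (SUP k\<in>{k. \<exists>t. strict_mono_on {..k} t \<and>
                    (\<forall>a\<le>k. machine_of \<sigma> j (t a) \<noteq> None) \<and>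
                    (\<forall>a<k. machine_of \<sigma> j (t a) \<noteq> machine_of \<sigma> j (t (Suc a)))}. enat k)"

text \<open>An algorithm is a map from what is known at a time \<open>t\<close> to the decision for that time. Known
  are the current time, the number of machines, the release time, weight and rates of the jobs
  released so far, and the completion times of the jobs completed so far; the lengths are not.
  The past decisions need not be recorded, since the algorithm can recompute them from these data.\<close>

record job_info =
  info_release :: real
  info_weight :: real
  info_rate :: "nat \<Rightarrow> real"

record observation =
  obs_time :: real
  obs_machines :: nat
  obs_arrived :: "nat \<Rightarrow> job_info option"
  obs_completed :: "nat \<Rightarrow> real option"

type_synonym algorithm = "observation \<Rightarrow> decision"

definition observe :: "sched_instance \<Rightarrow> schedule \<Rightarrow> real \<Rightarrow> observation" where
  "observe I \<sigma> t =
     \<lparr> obs_time = t,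
       obs_machines = machines I,
       obs_arrived = (\<lambda>j. if j \<in> jobs I \<and> release I j \<le> t
          then Some \<lparr> info_release = release I j, info_weight = weight I j,
                      info_rate = (\<lambda>i. if i < machines I then rate I i j else 0) \<rparr>
          else None),
       obs_completed = (\<lambda>j. if j \<in> jobs I \<and> completion I \<sigma> j \<le> ereal t
          then Some (real_of_ereal (completion I \<sigma> j)) else None) \<rparr>"

text \<open>The equation below is not circular: whether a job is completed by time \<open>t\<close> depends only on
  the decisions taken before \<open>t\<close>, up to a null set.\<close>

definition generates :: "algorithm \<Rightarrow> sched_instance \<Rightarrow> schedule \<Rightarrow> bool" where
  "generates A I \<sigma> \<longleftrightarrow> (\<forall>t. \<sigma> t = A (observe I \<sigma> t))"

definition speed_competitive :: "real \<Rightarrow> real \<Rightarrow> algorithm \<Rightarrow> bool" where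
  "speed_competitive s c A \<longleftrightarrow>
     (\<forall>I. valid_instance I \<longrightarrow>
        (\<exists>\<sigma>. generates A I \<sigma>) \<and>
        (\<forall>\<sigma>. generates A I \<sigma> \<longrightarrow> feasible s I \<sigma> \<and> cost I \<sigma> \<le> ereal c * opt I))"

end

theory Submission
  imports Defs
begin

text \<open>
  Every machine keeps its jobs in a queue and serves later positions at a higher share. The delay of
  a job is the weight up to its position divided by its rate. A job moves to the tail of another
  queue whenever this lowers its delay by a factor of more than \<open>1 + d\<close>; departures and the moves of
  other jobs never increase its delay. As the delay is at least \<open>w j\<close> and at most \<open>1 + d\<close> times the
  total weight, both divided by the best rate of the job, a job migrates only logarithmically often.

  Competitiveness is shown by dual fitting. Job \<open>j\<close> is charged at each time its share times the
  weight up to its position. With the polynomial shares of exponent \<open>N\<close> about \<open>4 / \<epsilon>\<close>, the total charge is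
  at least \<open>(1 + \<epsilon>) N / (N + 1)\<close> times the weighted flow time. On the other hand, the charge of \<open>j\<close>
  up to time \<open>t\<close> is \<open>O(N) w j (t - r j)\<close>, and the charge after \<open>t\<close> is at most the delay at time \<open>t\<close>
  times the length of \<open>j\<close>, because delays never increase. In equilibrium that delay is at most
  \<open>(1 + d) (load i + w j) / l i j\<close> for every machine \<open>i\<close>. Multiplying by the processing rates of an
  arbitrary schedule and integrating bounds the total charge by \<open>1 + d\<close> times the flow time of the
  algorithm plus \<open>O(N)\<close> times the cost of that schedule.
\<close>

text \<open>A state gives each job its machine and its rank in the order of the queues. A departure needs no
  change of the state: all notions below are relative to the set \<open>A\<close> of jobs present.\<close>

type_synonym qstate = "nat \<Rightarrow> nat \<times> nat"

section \<open>Queues, delays and polynomial shares\<close>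

definition ahead :: "qstate \<Rightarrow> nat set \<Rightarrow> nat \<Rightarrow> nat set" where
  "ahead S A j = {k \<in> A. fst (S k) = fst (S j) \<and> snd (S k) \<le> snd (S j)}"

definition load :: "(nat \<Rightarrow> real) \<Rightarrow> qstate \<Rightarrow> nat set \<Rightarrow> nat \<Rightarrow> real" where
  "load w S A i = sum w {k \<in> A. fst (S k) = i}"

definition delay :: "(nat \<Rightarrow> real) \<Rightarrow> (nat \<Rightarrow> nat \<Rightarrow> real) \<Rightarrow> qstate \<Rightarrow> nat set \<Rightarrow> nat \<Rightarrow> real" where
  "delay w l S A j = sum w (ahead S A j) / l (fst (S j)) j"

text \<open>The shares grow polynomially with the position in the queue: the jobs up to position \<open>P\<close> (measured
  in weight) together get the fraction \<open>(P / load)^N\<close> of the power.\<close>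

definition share :: "real \<Rightarrow> nat \<Rightarrow> (nat \<Rightarrow> real) \<Rightarrow> qstate \<Rightarrow> nat set \<Rightarrow> nat \<Rightarrow> real" where
  "share s N w S A j =
     s * (sum w (ahead S A j) ^ N - (sum w (ahead S A j) - w j) ^ N) / load w S A (fst (S j)) ^ N"

text \<open>Convexity: the graph of the power with exponent \<open>Suc N\<close> lies above its
  tangent at \<open>a\<close>. For positive \<open>a\<close> this is Bernoulli's inequality scaled
  by \<open>a ^ Suc N\<close>.\<close>

lemma power_AM_GM:
  fixes a b :: real
  assumes "0 \<le> a" "0 \<le> b"
  shows "real (Suc N) * (a ^ N * b) \<le> b ^ Suc N + real N * a ^ Suc N"
proof (cases "a = 0")
  case True
  then show ?thesis using assms by (cases N) auto
next
  case False
  with assms have a: "a > 0" by simp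
  have "1 + real (Suc N) * (b / a - 1) \<le> (1 + (b / a - 1)) ^ Suc N"
    by (rule Bernoulli_inequality) (use assms a in simp)
  then have "a ^ Suc N * (1 + real (Suc N) * (b / a - 1)) \<le> a ^ Suc N * (b / a) ^ Suc N"
    using a by (intro mult_left_mono) auto
  also have "\<dots> = b ^ Suc N"
    using a by (simp add: power_divide)
  also have "a ^ Suc N * (1 + real (Suc N) * (b / a - 1)) = real (Suc N) * (a ^ N * b) - real N * a ^ Suc N"
    using a by (simp add: field_simps)
  finally show ?thesis by simp
qed

lemma power_diff_le:
  fixes a b :: real
  assumes "0 \<le> a" "a \<le> b" "0 < N"
  shows "b ^ N - a ^ N \<le> real N * (b - a) * b ^ (N - 1)"
proof -
  have "b ^ N - a ^ N = (b - a) * (\<Sum>i<N. a ^ (N - Suc i) * b ^ i)"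
    by (rule power_diff_sumr2)
  also have "\<dots> \<le> (b - a) * (\<Sum>i<N. b ^ (N - 1))"
  proof (intro mult_left_mono sum_mono)
    fix i assume i: "i \<in> {..<N}"
    have "a ^ (N - Suc i) * b ^ i \<le> b ^ (N - Suc i) * b ^ i"
      using assms by (intro mult_right_mono power_mono) auto
    also have "\<dots> = b ^ (N - 1)" using i by (simp add: power_add[symmetric])
    finally show "a ^ (N - Suc i) * b ^ i \<le> b ^ (N - 1)" .
  qed (use assms in simp)
  finally show ?thesis by (simp add: mult_ac)
qed

text \<open>In the order of the ranks, \<open>P B j - w j\<close> is the position of the predecessor
  of \<open>j\<close>, so the first sum telescopes. The second is an upper Riemann-Stieltjes sum for
  the integral of \<open>x\<close> with respect to \<open>x ^ N\<close> from 0 to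
  \<open>sum w B\<close>. The induction adds elements by increasing rank, so an insertion leaves the
  earlier positions unchanged.\<close>

lemma ranked_sums:
  fixes w :: "'a \<Rightarrow> real" and f :: "'a \<Rightarrow> nat"
  assumes "finite B" "inj_on f B" "\<And>j. j \<in> B \<Longrightarrow> 0 < w j" "0 < N"
  defines "P \<equiv> \<lambda>B j. sum w {k \<in> B. f k \<le> f j}"
  shows "(\<Sum>j\<in>B. P B j ^ N - (P B j - w j) ^ N) = sum w B ^ N"
    and "real N / real (Suc N) * sum w B ^ Suc N
      \<le> (\<Sum>j\<in>B. (P B j ^ N - (P B j - w j) ^ N) * P B j)"
proof -
  have "(\<Sum>j\<in>B. P B j ^ N - (P B j - w j) ^ N) = sum w B ^ N \<and>
     real N / real (Suc N) * sum w B ^ Suc N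
      \<le> (\<Sum>j\<in>B. (P B j ^ N - (P B j - w j) ^ N) * P B j)"
    using assms(1-3)
  proof (induction B rule: finite_ranking_induct[where f = f])
    case empty
    then show ?case using assms(4) by simp
  next
    case (insert x B)
    show ?case
    proof (cases "x \<in> B")
      case True
      then show ?thesis using insert.IH insert.prems by (simp add: insert_absorb)
    next
      case False
      have inj: "inj_on f B" and pos: "\<And>j. j \<in> B \<Longrightarrow> 0 < w j" using insert.prems by auto
      have wx: "0 < w x" using insert.prems by auto
      have le: "f y \<le> f x" "f y \<noteq> f x" if "y \<in> B" for y
        using insert.hyps(2)[of y] insert.prems(1) False that by (auto simp: inj_on_def)
      have Px: "P (insert x B) x = sum w B + w x"
      proof -
        have "{k \<in> insert x B. f k \<le> f x} = insert x B" using le by auto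
        then show ?thesis using insert.hyps False by (simp add: P_def)
      qed
      have PB: "P (insert x B) j = P B j" if "j \<in> B" for j
      proof -
        have "{k \<in> insert x B. f k \<le> f j} = {k \<in> B. f k \<le> f j}" using le[OF that] by auto
        then show ?thesis by (simp add: P_def)
      qed
      let ?a = "sum w B" let ?b = "sum w B + w x"
      have a: "0 \<le> ?a" using pos by (intro sum_nonneg) (auto simp: less_imp_le)
      have IH: "(\<Sum>j\<in>B. P B j ^ N - (P B j - w j) ^ N) = ?a ^ N"
        "real N / real (Suc N) * ?a ^ Suc N \<le> (\<Sum>j\<in>B. (P B j ^ N - (P B j - w j) ^ N) * P B j)"
        using insert.IH[OF inj pos] by auto
      have 1: "(\<Sum>j\<in>insert x B. P (insert x B) j ^ N - (P (insert x B) j - w j) ^ N) = ?b ^ N"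
        using insert.hyps False PB Px IH(1) by simp
      \<comment> \<open>This is \<open>power_AM_GM\<close> rearranged: the term of the last element
        covers the growth of the left-hand side.\<close>
      have "real N * ?b ^ Suc N \<le> real N * ?a ^ Suc N + real (Suc N) * ((?b ^ N - ?a ^ N) * ?b)"
        using power_AM_GM[of ?a ?b N] a wx by (simp add: algebra_simps)
      then have "real N / real (Suc N) * ?b ^ Suc N
          \<le> real N / real (Suc N) * ?a ^ Suc N + (?b ^ N - ?a ^ N) * ?b"
        by (simp add: field_simps del: of_nat_Suc power_Suc)
      then have 2: "real N / real (Suc N) * ?b ^ Suc N \<le>
         (\<Sum>j\<in>insert x B. (P (insert x B) j ^ N - (P (insert x B) j - w j) ^ N) * P (insert x B) j)"
        using insert.hyps False PB Px IH(2) by simp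
      show ?thesis using 1 2 insert.hyps False by (simp add: add.commute)
    qed
  qed
  then show "(\<Sum>j\<in>B. P B j ^ N - (P B j - w j) ^ N) = sum w B ^ N"
    and "real N / real (Suc N) * sum w B ^ Suc N
      \<le> (\<Sum>j\<in>B. (P B j ^ N - (P B j - w j) ^ N) * P B j)" by auto
qed

context
  fixes w :: "nat \<Rightarrow> real" and S :: qstate and A :: "nat set" and s :: real and N :: nat
  assumes A: "finite A" "inj_on (\<lambda>j. snd (S j)) A" "\<And>j. j \<in> A \<Longrightarrow> 0 < w j"
    and N: "0 < N" and s: "0 \<le> s"
begin

lemma ahead_bounds:
  assumes "j \<in> A"
  shows "w j \<le> sum w (ahead S A j)" "sum w (ahead S A j) \<le> load w S A (fst (S j))"
proof -
  show "w j \<le> sum w (ahead S A j)"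
    using A assms by (intro member_le_sum) (auto simp: ahead_def less_imp_le)
  show "sum w (ahead S A j) \<le> load w S A (fst (S j))"
    unfolding load_def ahead_def using A by (intro sum_mono2) (auto simp: less_imp_le)
qed

lemma share_nonneg:
  assumes "j \<in> A"
  shows "0 \<le> share s N w S A j"
proof -
  have "(sum w (ahead S A j) - w j) ^ N \<le> sum w (ahead S A j) ^ N"
    using ahead_bounds[OF assms] A(3)[OF assms] by (intro power_mono) auto
  then show ?thesis
    using ahead_bounds[OF assms] A(3)[OF assms] s unfolding share_def
    by (intro divide_nonneg_nonneg mult_nonneg_nonneg zero_le_power) auto
qed

text \<open>The mean value bound \<open>power_diff_le\<close> yields
  \<open>N * w j * P ^ (N - 1)\<close>; the factor \<open>P\<close> completes the power, which
  cancels against that of the load. It is the source of the linear bound on the charge per unit of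
  time.\<close>

lemma share_ahead_le:
  assumes "j \<in> A"
  shows "share s N w S A j * sum w (ahead S A j) \<le> s * real N * w j"
proof -
  let ?P = "sum w (ahead S A j)" and ?L = "load w S A (fst (S j))"
  have b: "0 < w j" "w j \<le> ?P" "?P \<le> ?L" using ahead_bounds[OF assms] A(3)[OF assms] by auto
  have "(?P ^ N - (?P - w j) ^ N) * ?P \<le> (real N * (?P - (?P - w j)) * ?P ^ (N - 1)) * ?P"
    using b N by (intro mult_right_mono power_diff_le) auto
  also have "\<dots> = real N * w j * ?P ^ N" using N by (cases N) auto
  also have "\<dots> \<le> real N * w j * ?L ^ N" using b by (intro mult_left_mono power_mono) auto
  finally have "s * ((?P ^ N - (?P - w j) ^ N) * ?P) \<le> s * (real N * w j * ?L ^ N)"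
    using s by (rule mult_left_mono)
  moreover have "0 < ?L ^ N" using b by simp
  ultimately show ?thesis unfolding share_def by (simp add: field_simps)
qed

lemma sum_share_machine:
  "(\<Sum>j | j \<in> A \<and> fst (S j) = i. share s N w S A j) \<le> s"
  "s * (real N / real (Suc N)) * load w S A i
    \<le> (\<Sum>j | j \<in> A \<and> fst (S j) = i. share s N w S A j * sum w (ahead S A j))"
proof -
  let ?B = "{j \<in> A. fst (S j) = i}"
  let ?P = "\<lambda>j. sum w {k \<in> ?B. snd (S k) \<le> snd (S j)}"
  have B: "finite ?B" "inj_on (\<lambda>j. snd (S j)) ?B" "\<And>j. j \<in> ?B \<Longrightarrow> 0 < w j"
    using A by (auto intro: inj_on_subset)
  have P: "sum w (ahead S A j) = ?P j" if "j \<in> ?B" for j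
    using that unfolding ahead_def by (intro sum.cong) auto
  have L: "load w S A (fst (S j)) = sum w ?B" if "j \<in> ?B" for j
    using that unfolding load_def by auto
  have L': "load w S A i = sum w ?B" by (simp add: load_def)
  have Bs: "0 \<le> sum w ?B" using A(3) by (intro sum_nonneg) (auto simp: less_imp_le)
  note R = ranked_sums[OF B N]
  have "(\<Sum>j\<in>?B. share s N w S A j) = (\<Sum>j\<in>?B. s / sum w ?B ^ N * (?P j ^ N - (?P j - w j) ^ N))"
    unfolding share_def using P L by (intro sum.cong) auto
  also have "\<dots> = s / sum w ?B ^ N * sum w ?B ^ N"
    by (simp only: sum_distrib_left[symmetric] R(1))
  \<comment> \<open>On an empty machine the quotient is a division by zero, so the product is
    0.\<close>
  also have "\<dots> \<le> s" using s Bs by (cases "sum w ?B = 0") (use N in auto)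
  finally show "(\<Sum>j | j \<in> A \<and> fst (S j) = i. share s N w S A j) \<le> s" by simp
  have "s * (real N / real (Suc N)) * load w S A i
      = s / sum w ?B ^ N * (real N / real (Suc N) * sum w ?B ^ Suc N)"
    unfolding L' by (cases "sum w ?B = 0") auto
  also have "\<dots> \<le> s / sum w ?B ^ N * (\<Sum>j\<in>?B. (?P j ^ N - (?P j - w j) ^ N) * ?P j)"
    using s Bs by (intro mult_left_mono R(2)) auto
  also have "\<dots> = (\<Sum>j\<in>?B. share s N w S A j * sum w (ahead S A j))"
    by (simp only: sum_distrib_left[of "s / sum w ?B ^ N" _ ?B], rule sum.cong) (auto simp: share_def P L)
  finally show "s * (real N / real (Suc N)) * load w S A i
    \<le> (\<Sum>j | j \<in> A \<and> fst (S j) = i. share s N w S A j * sum w (ahead S A j))" by simp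
qed

lemma sum_share_total:
  assumes "\<And>j. j \<in> A \<Longrightarrow> fst (S j) < m"
  shows "s * (real N / real (Suc N)) * sum w A \<le> (\<Sum>j\<in>A. share s N w S A j * sum w (ahead S A j))"
proof -
  have "sum w A = (\<Sum>i<m. load w S A i)"
    unfolding load_def using A(1) assms by (subst sum.group) auto
  moreover have "(\<Sum>j\<in>A. share s N w S A j * sum w (ahead S A j)) =
      (\<Sum>i<m. \<Sum>j | j \<in> A \<and> fst (S j) = i. share s N w S A j * sum w (ahead S A j))"
    using A(1) assms by (subst sum.group) auto
  ultimately show ?thesis
    by (simp only: sum_distrib_left[of _ "load w S A"]) (intro sum_mono sum_share_machine(2))
qed

end

section \<open>Equilibria of selfish migration\<close>

definition assignable :: "(nat \<Rightarrow> nat \<Rightarrow> real) \<Rightarrow> nat \<Rightarrow> qstate \<Rightarrow> nat set \<Rightarrow> bool" where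
  "assignable l m S A \<longleftrightarrow> inj_on (\<lambda>j. snd (S j)) A \<and> (\<forall>j\<in>A. fst (S j) < m \<and> 0 < l (fst (S j)) j)"

text \<open>\<open>improves\<close> also constrains jobs that change machines several times between \<open>S\<close> and \<open>S'\<close>; this makes
  it transitive, and so only the outcome of the selfish migration has to be described.\<close>

definition improves where
  "improves d w l A' S A S' \<longleftrightarrow> (\<forall>j\<in>A \<inter> A'. delay w l S' A j \<le> delay w l S A' j \<and>
     (fst (S' j) \<noteq> fst (S j) \<longrightarrow> (1 + d) * delay w l S' A j < delay w l S A' j))"

definition equilibrium where
  "equilibrium d w l m A S \<longleftrightarrow>
     (\<forall>j\<in>A. \<forall>i<m. 0 < l i j \<longrightarrow> delay w l S A j \<le> (1 + d) * (load w S A i + w j) / l i j)"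

text \<open>\<open>A'\<close> and \<open>S\<close> belong to the moment before an event,
  \<open>A\<close> and \<open>S'\<close> to the moment after it; jobs may have left and arrived in
  between.\<close>

definition settled where
  "settled d w l m A' S A S' \<longleftrightarrow>
     assignable l m S' A \<and> improves d w l A' S A S' \<and> equilibrium d w l m A S'"

text \<open>An improving state with the least total delay is in equilibrium, since a profitable deviation to
  the tail of another queue delays nobody else. The minimum exists because the delays take only
  finitely many values.\<close>

lemma settled_exists:
  fixes w :: "nat \<Rightarrow> real"
  assumes A: "finite A" "finite A'" "\<And>j. j \<in> A \<union> A' \<Longrightarrow> 0 < w j"
    and good: "\<And>j. j \<in> A \<Longrightarrow> \<exists>i<m. 0 < l i j"
    and S: "assignable l m S A'" and d: "0 \<le> d"
  shows "\<exists>S'. settled d w l m A' S A S'"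
proof -
  define f where "f S' = (\<Sum>j\<in>A. delay w l S' A j)" for S'
  define Q where "Q = {S'. assignable l m S' A \<and> improves d w l A' S A S'}"
  \<comment> \<open>Ranks are arbitrary naturals, so \<open>Q\<close> may be infinite. A delay is
    however determined by a subset of \<open>A\<close> and a machine, and \<open>U j\<close>
    collects these finitely many values.\<close>
  define U where "U j = (\<lambda>(B, i). sum w B / l i j) ` (Pow A \<times> {..<m})" for j
  have "f ` Q \<subseteq> (\<lambda>g. \<Sum>j\<in>A. g j) ` (PiE A U)"
  proof (rule image_subsetI)
    fix S' assume "S' \<in> Q"
    have "delay w l S' A x \<in> U x" if "x \<in> A" for x
    proof -
      have "(ahead S' A x, fst (S' x)) \<in> Pow A \<times> {..<m}"
        using \<open>S' \<in> Q\<close> that by (auto simp: Q_def assignable_def ahead_def)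
      then show ?thesis unfolding U_def delay_def by (rule rev_image_eqI) simp
    qed
    then have "restrict (delay w l S' A) A \<in> PiE A U" by auto
    moreover have "f S' = (\<Sum>j\<in>A. restrict (delay w l S' A) A j)" by (simp add: f_def)
    ultimately show "f S' \<in> (\<lambda>g. \<Sum>j\<in>A. g j) ` (PiE A U)" by blast
  qed
  moreover have "finite (PiE A U)" using A by (intro finite_PiE) (auto simp: U_def)
  ultimately have fin: "finite (f ` Q)" using finite_surj by blast
  have mono_delay: "delay w l S2 A2 j \<le> delay w l S1 A1 j"
    if "ahead S2 A2 j \<subseteq> ahead S1 A1 j" "fst (S2 j) = fst (S1 j)" "0 < l (fst (S1 j)) j"
      "finite A1" "\<And>j. j \<in> A1 \<Longrightarrow> 0 < w j" for S1 S2 :: qstate and A1 A2 j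
    unfolding delay_def that(2) using that
    by (intro divide_right_mono sum_mono2) (auto simp: ahead_def less_imp_le)
  define M where "M = Suc (\<Sum>k\<in>A'. snd (S k))"
  \<comment> \<open>A witness that \<open>Q\<close> is nonempty: old jobs stay in place, and new
    ones queue up behind them on some machine that can process them. The offset \<open>M\<close>
    exceeds all old ranks, and adding \<open>j\<close> keeps the new ranks distinct.\<close>
  define S0 where "S0 j = (if j \<in> A' then S j else (SOME i. i < m \<and> 0 < l i j, M + j))" for j
  have M: "snd (S k) < M" if "k \<in> A'" for k
    unfolding M_def less_Suc_eq_le using A that by (intro member_le_sum) auto
  have some: "(SOME i. i < m \<and> 0 < l i j) < m \<and> 0 < l (SOME i. i < m \<and> 0 < l i j) j"
    if "j \<in> A" for j using someI_ex[of "\<lambda>i. i < m \<and> 0 < l i j"] good[OF that] by blast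
  have "S0 \<in> Q"
  proof -
    have "inj_on (\<lambda>j. snd (S0 j)) A"
    proof (rule inj_onI)
      fix x y assume "x \<in> A" "y \<in> A" "snd (S0 x) = snd (S0 y)"
      then show "x = y" using M[of x] M[of y] S
        by (auto simp: S0_def assignable_def inj_on_def split: if_splits)
    qed
    then have "assignable l m S0 A"
      using S some by (auto simp: assignable_def S0_def)
    moreover have "improves d w l A' S A S0"
      unfolding improves_def
    proof (intro ballI conjI impI)
      fix j assume j: "j \<in> A \<inter> A'"
      show "delay w l S0 A j \<le> delay w l S A' j"
      proof (rule mono_delay)
        show "ahead S0 A j \<subseteq> ahead S A' j"
          using j M[of j] by (auto simp: ahead_def S0_def split: if_splits)
      qed (use j S A in \<open>auto simp: S0_def assignable_def\<close>)
      show "(1 + d) * delay w l S0 A j < delay w l S A' j" if "fst (S0 j) \<noteq> fst (S j)"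
        using that j by (simp add: S0_def)
    qed
    ultimately show ?thesis by (simp add: Q_def)
  qed
  then have "f ` Q \<noteq> {}" by auto
  then obtain S' where S': "S' \<in> Q" "f S' = Min (f ` Q)"
    using Min_in[OF fin] by (metis imageE)
  have min: "f S' \<le> f T" if "T \<in> Q" for T
    using S' fin that by (metis Min_le imageI)
  have ass: "assignable l m S' A" and imp: "improves d w l A' S A S'"
    using S' by (auto simp: Q_def)
  have "equilibrium d w l m A S'"
    unfolding equilibrium_def
  proof (intro ballI allI impI, rule ccontr)
    fix j i assume j: "j \<in> A" and i: "i < m" "0 < l i j"
      and "\<not> delay w l S' A j \<le> (1 + d) * (load w S' A i + w j) / l i j"
    then have gt: "(1 + d) * ((load w S' A i + w j) / l i j) < delay w l S' A j" by simp
    define R where "R = Suc (\<Sum>k\<in>A. snd (S' k))"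
    have R: "snd (S' k) < R" if "k \<in> A" for k
      unfolding R_def less_Suc_eq_le using A that by (intro member_le_sum) auto
    \<comment> \<open>The profitable deviation: \<open>j\<close> goes to the tail of machine
      \<open>i\<close>, as \<open>R\<close> exceeds all ranks in use.\<close>
    define T where "T = S'(j := (i, R))"
    have other: "delay w l T A k \<le> delay w l S' A k" if "k \<in> A" "k \<noteq> j" for k
    proof (rule mono_delay)
      show "ahead T A k \<subseteq> ahead S' A k"
        using that R[of k] by (auto simp: ahead_def T_def split: if_splits)
    qed (use that ass A in \<open>auto simp: T_def assignable_def\<close>)
    have "sum w (ahead T A j) \<le> sum w (insert j {k \<in> A. fst (S' k) = i})"
      using A j by (intro sum_mono2) (auto simp: ahead_def T_def less_imp_le split: if_splits)
    also have "\<dots> \<le> load w S' A i + w j"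
      using A j less_imp_le[OF A(3)[of j]]
      by (cases "fst (S' j) = i") (auto simp: load_def insert_absorb)
    finally have dj: "delay w l T A j \<le> (load w S' A i + w j) / l i j"
      using i by (simp add: delay_def T_def divide_right_mono)
    have pos: "0 \<le> delay w l T A j"
      unfolding delay_def T_def using A i
      by (intro divide_nonneg_nonneg sum_nonneg) (auto simp: ahead_def less_imp_le)
    have own: "(1 + d) * delay w l T A j < delay w l S' A j"
      using gt mult_left_mono[OF dj, of "1 + d"] d by linarith
    then have own': "delay w l T A j < delay w l S' A j"
      using mult_right_mono[OF _ pos, of 1 "1 + d"] d by simp
    have "f T < f S'"
      unfolding f_def by (rule sum_strict_mono_ex1[OF A(1)])
        (use other own' j in \<open>auto simp: less_imp_le intro: le_less_trans\<close>, metis less_eq_real_def)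
    moreover have "T \<in> Q"
    proof -
      have "inj_on (\<lambda>j. snd (T j)) A"
        using ass R by (auto simp: assignable_def T_def inj_on_def split: if_splits)
      then have "assignable l m T A"
        using ass i by (auto simp: assignable_def T_def)
      moreover have "improves d w l A' S A T"
        unfolding improves_def
      proof (intro ballI conjI impI)
        fix k assume k: "k \<in> A \<inter> A'"
        have 1: "delay w l S' A k \<le> delay w l S A' k"
          "fst (S' k) \<noteq> fst (S k) \<Longrightarrow> (1 + d) * delay w l S' A k < delay w l S A' k"
          using imp k by (auto simp: improves_def)
        show "delay w l T A k \<le> delay w l S A' k"
          using 1 own' other[of k] k by (cases "k = j") auto
        show "(1 + d) * delay w l T A k < delay w l S A' k" if ne: "fst (T k) \<noteq> fst (S k)"
        proof (cases "k = j")
          \<comment> \<open>The deviation alone gains the factor \<open>1 + d\<close> over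
            \<open>S'\<close>, and \<open>S'\<close> is no worse than \<open>S\<close>; where
            \<open>j\<close> was in between does not matter.\<close>
          case True then show ?thesis using own 1 by simp
        next
          case False
          then have "fst (S' k) \<noteq> fst (S k)" using ne by (simp add: T_def)
          moreover have "(1 + d) * delay w l T A k \<le> (1 + d) * delay w l S' A k"
            using other[of k] False k d by (intro mult_left_mono) auto
          ultimately show ?thesis using 1(2) by linarith
        qed
      qed
      ultimately show ?thesis by (simp add: Q_def)
    qed
    ultimately show False using min by fastforce
  qed
  then show ?thesis using ass imp by (auto simp: settled_def)
qed

section \<open>Completion times\<close>

text \<open>Induction on the jump points: to the left of \<open>e\<close> the function sees only
  \<open>E\<close>, to its right it is of the same form with \<open>g\<close> composed with
  \<open>insert e\<close>. At \<open>e\<close> itself the two pieces overlap, hence the negligible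
  exception.\<close>

lemma integrable_stepwise:
  fixes g :: "real set \<Rightarrow> real"
  assumes "finite E"
  shows "(\<lambda>t. g (E \<inter> {..t})) integrable_on {a..b}"
  using assms
proof (induction E arbitrary: g rule: finite_induct)
  case empty
  then show ?case by (simp add: integrable_const_ivl)
next
  case (insert e E)
  let ?h1 = "\<lambda>t. g (E \<inter> {..t})" and ?h2 = "\<lambda>t. g (insert e (E \<inter> {..t}))"
  have sub: "?h1 integrable_on {c..d}" "?h2 integrable_on {c..d}"
    if "{c..d} \<subseteq> {a..b}" for c d
    using that insert.IH[of g] insert.IH[of "\<lambda>X. g (insert e X)"] integrable_on_subinterval
    by blast+
  have "{..e} \<inter> {a..b} = {a..min b e}" "{e..} \<inter> {a..b} = {max a e..b}" by auto
  then have "(\<lambda>t. if t \<in> {..e} then ?h1 t else 0) integrable_on {a..b}"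
    "(\<lambda>t. if t \<in> {e..} then ?h2 t else 0) integrable_on {a..b}"
    unfolding integrable_restrict_Int by (simp_all add: sub)
  then have "(\<lambda>t. (if t \<in> {..e} then ?h1 t else 0) + (if t \<in> {e..} then ?h2 t else 0))
      integrable_on {a..b}"
    by (rule integrable_add)
  then show ?case
  proof (rule integrable_spike[of _ _ "{e}"])
    show "negligible {e}" by simp
    fix x assume "x \<in> {a..b} - {e}"
    then show "g (insert e E \<inter> {..x}) =
        (if x \<in> {..e} then ?h1 x else 0) + (if x \<in> {e..} then ?h2 x else 0)"
      by (cases "x < e") auto
  qed
qed

text \<open>\<open>completion\<close> for an arbitrary rate function \<open>f\<close>, so that the
  completion times under two schedules can be compared through their rates.\<close>

definition finish :: "real \<Rightarrow> real \<Rightarrow> (real \<Rightarrow> real) \<Rightarrow> ereal" where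
  "finish r p f = Inf (ereal ` {T. r \<le> T \<and> p \<le> integral {r..T} f})"

lemma integral_finish_gt:
  assumes "r \<le> T" "ereal T < finish r p f"
  shows "integral {r..T} f < p"
  using assms Inf_lower[of "ereal T" "ereal ` {T. r \<le> T \<and> p \<le> integral {r..T} f}"]
  unfolding finish_def by (force simp: not_less[symmetric])

lemma finish_ge:
  assumes "\<And>T. r \<le> T \<Longrightarrow> T < \<tau> \<Longrightarrow> integral {r..T} f < p"
  shows "ereal \<tau> \<le> finish r p f"
  unfolding finish_def using assms by (intro Inf_greatest) (force simp: not_less[symmetric])

lemma finish_le:
  assumes "r \<le> T" "p \<le> integral {r..T} f"
  shows "finish r p f \<le> ereal T"
  unfolding finish_def using assms by (intro Inf_lower) auto

text \<open>The indefinite integral is continuous. By compactness the infimum is attained, and by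
  the intermediate value theorem the integral there is exactly \<open>p\<close>.\<close>

lemma finish_cases:
  assumes int: "\<And>a b. f integrable_on {a..b}" and nn: "\<And>t. 0 \<le> f t" and p: "0 < p"
  obtains (Inf) "finish r p f = \<infinity>" "\<And>T. integral {r..T} f < p"
  | (fin) c where "finish r p f = ereal c" "r < c" "integral {r..c} f = p"
proof (cases "\<exists>T\<ge>r. p \<le> integral {r..T} f")
  case False
  then have empty: "{T. r \<le> T \<and> p \<le> integral {r..T} f} = {}" by auto
  have "finish r p f = \<infinity>" unfolding finish_def empty by (simp add: top_ereal_def)
  moreover have "integral {r..T} f < p" for T
    using False p by (cases "r \<le> T") (auto simp: not_le dest: spec[of _ T])
  ultimately show ?thesis by (rule Inf)
next
  case True
  then obtain b where b: "r \<le> b" "p \<le> integral {r..b} f" by auto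
  let ?F = "\<lambda>T. integral {r..T} f"
  have cont: "continuous_on {r..b} ?F" by (rule indefinite_integral_continuous_1[OF int])
  have "{T \<in> {r..b}. p \<le> ?F T} = {r..b} \<inter> ?F -` {p..}" by auto
  also have "compact \<dots>"
    using continuous_closed_preimage[OF cont closed_atLeastAtMost closed_atLeast]
    by (metis compact_Icc compact_Int_closed inf.absorb_iff2 inf_le1 inf_left_commute)
  finally have "compact {T \<in> {r..b}. p \<le> ?F T}" .
  moreover have "b \<in> {T \<in> {r..b}. p \<le> ?F T}" using b by auto
  ultimately obtain c where c: "c \<in> {T \<in> {r..b}. p \<le> ?F T}"
    "\<And>T. T \<in> {T \<in> {r..b}. p \<le> ?F T} \<Longrightarrow> c \<le> T"
    using compact_attains_inf[of "{T \<in> {r..b}. p \<le> ?F T}"] by blast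
  have least: "?F T < p" if "T < c" "r \<le> T" for T
    using c(2)[of T] that c(1) by force
  have rc: "r \<noteq> c" using c(1) p by auto
  have "?F c = p"
  proof (rule ccontr)
    assume "?F c \<noteq> p"
    then have "p < ?F c" using c by auto
    moreover have "continuous_on {r..c} ?F" by (rule indefinite_integral_continuous_1[OF int])
    ultimately obtain x where "r \<le> x" "x \<le> c" "?F x = p"
      using IVT'[of ?F r p c] p c by auto
    then show False using least[of x] \<open>p < ?F c\<close> by (cases "x = c") auto
  qed
  moreover have "finish r p f = ereal c"
    using finish_ge[of r c f p] least finish_le[of r c p f] c by (auto intro: antisym)
  ultimately show ?thesis using rc c by (intro fin[of c]) auto
qed

text \<open>Causality: rates that agree before \<tau> have the same integrals up to \<tau>, since
  one point is negligible. A completion by \<tau> is therefore preserved, and a later one cannot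
  move before \<tau>.\<close>

lemma finish_cong:
  assumes f: "\<And>a b. f integrable_on {a..b}" "\<And>t. 0 \<le> f t"
    and g: "\<And>a b. g integrable_on {a..b}" "\<And>t. 0 \<le> g t"
    and p: "0 < p" and eq: "\<And>t. t < \<tau> \<Longrightarrow> f t = g t"
  shows "finish r p f \<le> ereal \<tau> \<Longrightarrow> finish r p g = finish r p f"
    and "ereal \<tau> \<le> finish r p f \<Longrightarrow> ereal \<tau> \<le> finish r p g"
proof -
  have I: "integral {r..T} g = integral {r..T} f" if "T \<le> \<tau>" for T
    by (rule integral_spike[of "{\<tau>}"]) (use eq that in auto)
  show "finish r p g = finish r p f" if "finish r p f \<le> ereal \<tau>"
  proof (cases rule: finish_cases[OF f p, of r])
    case (2 c)
    have "finish r p g \<le> ereal c" using 2 that I[of c] by (intro finish_le) auto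
    moreover have "ereal c \<le> finish r p g"
      by (rule finish_ge) (use 2 that I integral_finish_gt[of r _ p f] in auto)
    ultimately show ?thesis using 2 by (auto intro: antisym)
  qed (use that in auto)
  show "ereal \<tau> \<le> finish r p g" if le: "ereal \<tau> \<le> finish r p f"
  proof (rule finish_ge)
    fix T assume "r \<le> T" "T < \<tau>"
    then show "integral {r..T} g < p"
      using I[of T] integral_finish_gt[of r T p f] le less_le_trans[of "ereal T" "ereal \<tau>"] by auto
  qed
qed

section \<open>The algorithm\<close>

definition latest :: "(real \<Rightarrow> nat set) \<Rightarrow> real list \<Rightarrow> nat set" where
  "latest L es = (case es of [] \<Rightarrow> {} | e # _ \<Rightarrow> L e)"

text \<open>The event times are listed from the latest to the earliest.\<close>

primrec sim ::
  "real \<Rightarrow> (nat \<Rightarrow> real) \<Rightarrow> (nat \<Rightarrow> nat \<Rightarrow> real) \<Rightarrow> nat \<Rightarrow> (real \<Rightarrow> nat set) \<Rightarrow> real list \<Rightarrow> qstate" where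
  "sim d w l m L [] = (\<lambda>_. (0, 0))"
| "sim d w l m L (e # es) = (SOME S. settled d w l m (latest L es) (sim d w l m L es) (L e) S)"

text \<open>As the equation holds for every \<open>S'\<close>, the choice operator in
  \<open>sim\<close> picks the same state whether the data come from an observation or from the full
  instance.\<close>

lemma settled_cong:
  assumes w: "\<And>j. j \<in> A \<union> A' \<Longrightarrow> w1 j = w2 j"
    and l: "\<And>i j. j \<in> A \<union> A' \<Longrightarrow> l1 i j = l2 i j"
  shows "settled d w1 l1 m A' S A S' = settled d w2 l2 m A' S A S'"
proof -
  have D: "delay w1 l1 T B j = delay w2 l2 T B j" if "j \<in> B" "B = A \<or> B = A'" for T B j
    using that w l unfolding delay_def
    by (intro arg_cong2[of _ _ _ _ "(/)"] sum.cong) (auto simp: ahead_def)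
  have L: "load w1 T A i = load w2 T A i" for T i
    unfolding load_def using w by (intro sum.cong) auto
  show ?thesis
    unfolding settled_def assignable_def improves_def equilibrium_def
    using w l by (simp add: D L)
qed

lemma sim_cong:
  assumes "\<And>e. e \<in> set es \<Longrightarrow> L1 e = L2 e"
    and "\<And>e j. e \<in> set es \<Longrightarrow> j \<in> L2 e \<Longrightarrow> w1 j = w2 j"
    and "\<And>e j i. e \<in> set es \<Longrightarrow> j \<in> L2 e \<Longrightarrow> l1 i j = l2 i j"
  shows "sim d w1 l1 m L1 es = sim d w2 l2 m L2 es"
  using assms
proof (induction es)
  case (Cons e es)
  have "latest L1 es = latest L2 es" "L1 e = L2 e"
    using Cons.prems(1) by (auto simp: latest_def split: list.split)
  moreover have "sim d w1 l1 m L1 es = sim d w2 l2 m L2 es"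
    by (rule Cons.IH) (meson Cons.prems list.set_intros(2))+
  moreover have "settled d w1 l1 m (latest L2 es) S (L2 e) = settled d w2 l2 m (latest L2 es) S (L2 e)" for S
  proof (intro ext settled_cong)
    fix j assume "j \<in> L2 e \<union> latest L2 es"
    then obtain e' where "e' \<in> set (e # es)" "j \<in> L2 e'"
      by (auto simp: latest_def split: list.splits)
    then show "w1 j = w2 j" "l1 i j = l2 i j" for i using Cons.prems by blast+
  qed
  ultimately show ?case by simp
qed simp

context
  fixes d :: real and w :: "nat \<Rightarrow> real" and l :: "nat \<Rightarrow> nat \<Rightarrow> real" and m :: nat and L :: "real \<Rightarrow> nat set"
  assumes d: "0 \<le> d" and fin: "\<And>e. finite (L e)" and w: "\<And>e j. j \<in> L e \<Longrightarrow> 0 < w j"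
    and good: "\<And>e j. j \<in> L e \<Longrightarrow> \<exists>i<m. 0 < l i j"
begin

text \<open>The choice in \<open>sim\<close> is justified by \<open>settled_exists\<close> only if
  the previous state is assignable, and a settled state is again assignable. So assignability is
  proved first, by induction along the events.\<close>

lemma sim_settled:
  "settled d w l m (latest L es) (sim d w l m L es) (L e) (sim d w l m L (e # es))"
  and sim_assignable: "assignable l m (sim d w l m L es) (latest L es)"
proof -
  have step: "settled d w l m (latest L es) (sim d w l m L es) (L e) (sim d w l m L (e # es))"
    if "assignable l m (sim d w l m L es) (latest L es)" for es e
  proof -
    have "\<exists>S. settled d w l m (latest L es) (sim d w l m L es) (L e) S"
    proof (rule settled_exists[OF _ _ _ _ that d])
      show "finite (latest L es)" by (auto simp: latest_def fin split: list.split)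
      show "0 < w j" if "j \<in> L e \<union> latest L es" for j
        using that w by (auto simp: latest_def split: list.splits)
    qed (use fin good in auto)
    then show ?thesis unfolding sim.simps by (rule someI_ex)
  qed
  have ass: "assignable l m (sim d w l m L es) (latest L es)" for es
  proof (induction es)
    case Nil
    then show ?case by (simp add: latest_def assignable_def)
  next
    case (Cons e es)
    have "assignable l m (sim d w l m L (e # es)) (L e)"
      using step[OF Cons, of e] unfolding settled_def by blast
    then show ?case by (simp only: latest_def list.case)
  qed
  show "settled d w l m (latest L es) (sim d w l m L es) (L e) (sim d w l m L (e # es))"
    by (rule step[OF ass])
  show "assignable l m (sim d w l m L es) (latest L es)" by (rule ass)
qed

lemma sim_delay_nonneg: "j \<in> latest L es \<Longrightarrow> 0 \<le> delay w l (sim d w l m L es) (latest L es) j"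
proof -
  assume j: "j \<in> latest L es"
  have "0 \<le> w k" if "k \<in> latest L es" for k
  proof -
    have "\<exists>e. k \<in> L e" using that by (cases es) (auto simp: latest_def)
    then show ?thesis using w less_imp_le by blast
  qed
  moreover have "0 < l (fst (sim d w l m L es j)) j"
    using sim_assignable[of es] j by (simp add: assignable_def)
  ultimately show ?thesis
    unfolding delay_def ahead_def by (intro divide_nonneg_pos sum_nonneg) auto
qed

text \<open>Transitivity of improvement along events at which \<open>j\<close> is present. If the
  first and the last machine differ, then some step changed the machine; that step supplies the
  factor \<open>1 + d\<close>, and the others do not increase the delay.\<close>

lemma sim_delay_mono:
  assumes "j \<in> latest L ys" "\<And>e. e \<in> set zs \<Longrightarrow> j \<in> L e"
  shows "delay w l (sim d w l m L (zs @ ys)) (latest L (zs @ ys)) j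
      \<le> delay w l (sim d w l m L ys) (latest L ys) j \<and>
    (fst (sim d w l m L (zs @ ys) j) \<noteq> fst (sim d w l m L ys j) \<longrightarrow>
      (1 + d) * delay w l (sim d w l m L (zs @ ys)) (latest L (zs @ ys)) j
      < delay w l (sim d w l m L ys) (latest L ys) j)"
  using assms(2)
proof (induction zs)
  case (Cons e zs)
  let ?S = "sim d w l m L (zs @ ys)" and ?A = "latest L (zs @ ys)"
  let ?S' = "sim d w l m L (e # zs @ ys)"
  let ?T = "sim d w l m L ys" and ?B = "latest L ys"
  have j: "j \<in> L e \<inter> ?A"
    using Cons.prems assms(1) by (cases zs) (auto simp: latest_def)
  have 1: "delay w l ?S' (L e) j \<le> delay w l ?S ?A j"
    "fst (?S' j) \<noteq> fst (?S j) \<Longrightarrow> (1 + d) * delay w l ?S' (L e) j < delay w l ?S ?A j"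
    using sim_settled[of "zs @ ys" e] j unfolding settled_def improves_def by blast+
  have 2: "delay w l ?S ?A j \<le> delay w l ?T ?B j"
    "fst (?S j) \<noteq> fst (?T j) \<Longrightarrow> (1 + d) * delay w l ?S ?A j < delay w l ?T ?B j"
    using Cons by auto
  have 3: "(1 + d) * delay w l ?S' (L e) j \<le> (1 + d) * delay w l ?S ?A j"
    using 1(1) d by (intro mult_left_mono) auto
  have "fst (?S' j) \<noteq> fst (?T j) \<Longrightarrow> (1 + d) * delay w l ?S' (L e) j < delay w l ?T ?B j"
    using 1(2) 2 3 by (cases "fst (?S' j) = fst (?S j)") (auto simp del: sim.simps)
  then show ?case using 1(1) 2(1) by (simp add: latest_def del: sim.simps)
qed simp

end

definition decide :: "real \<Rightarrow> nat \<Rightarrow> (nat \<Rightarrow> real) \<Rightarrow> qstate \<Rightarrow> nat set \<Rightarrow> decision" where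
  "decide s N w S A j = (if j \<in> A then Some (fst (S j), share s N w S A j) else None)"

text \<open>Decisions have no memory, so the whole simulation is rerun at every time.
  \<open>L e\<close> recovers the jobs present at a past time \<open>e\<close> from the recorded
  release and completion times.\<close>

definition migrate_alg :: "real \<Rightarrow> real \<Rightarrow> nat \<Rightarrow> algorithm" where
  "migrate_alg d s N obs =
    (let w = (\<lambda>j. info_weight (the (obs_arrived obs j)));
         l = (\<lambda>i j. info_rate (the (obs_arrived obs j)) i);
         m = obs_machines obs;
         L = (\<lambda>e. {j. \<exists>x. obs_arrived obs j = Some x \<and> info_release x \<le> e \<and>
                (\<exists>i<m. 0 < info_rate x i) \<and> \<not> (\<exists>c. obs_completed obs j = Some c \<and> c \<le> e)});
         es = rev (sorted_list_of_set
                ({info_release x |x j. obs_arrived obs j = Some x} \<union>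
                 {c |c j. obs_completed obs j = Some c}))
     in decide s N w (sim d w l m L es) (latest L es))"

text \<open>Observations show the rate \<open>0\<close> for machine numbers that are out of range.\<close>

definition masked_rate :: "sched_instance \<Rightarrow> nat \<Rightarrow> nat \<Rightarrow> real" where
  "masked_rate I i j = (if i < machines I then rate I i j else 0)"

text \<open>Jobs that no machine can process are ignored: they would make all delays meaningless, as
  \<open>x / 0 = 0\<close>, and if there is one, then the optimum is infinite.\<close>

definition live :: "sched_instance \<Rightarrow> (nat \<Rightarrow> ereal) \<Rightarrow> real \<Rightarrow> nat set" where
  "live I C t = {j \<in> jobs I. release I j \<le> t \<and> (\<exists>i<machines I. 0 < rate I i j) \<and> ereal t < C j}"

definition events :: "sched_instance \<Rightarrow> (nat \<Rightarrow> ereal) \<Rightarrow> real set" where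
  "events I C = release I ` jobs I \<union> {c. \<exists>j\<in>jobs I. C j = ereal c}"

definition past :: "sched_instance \<Rightarrow> (nat \<Rightarrow> ereal) \<Rightarrow> real \<Rightarrow> real list" where
  "past I C t = rev (sorted_list_of_set (events I C \<inter> {..t}))"

definition state_at :: "real \<Rightarrow> sched_instance \<Rightarrow> (nat \<Rightarrow> ereal) \<Rightarrow> real \<Rightarrow> qstate" where
  "state_at d I C t = sim d (weight I) (masked_rate I) (machines I) (live I C) (past I C t)"

text \<open>\<open>C\<close> is a guess of the completion times. Taking it as a parameter removes
  the circularity of \<open>generates\<close>; the generated schedule is recovered as a fixed
  point.\<close>

definition sched :: "real \<Rightarrow> real \<Rightarrow> nat \<Rightarrow> sched_instance \<Rightarrow> (nat \<Rightarrow> ereal) \<Rightarrow> schedule" where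
  "sched d s N I C t = decide s N (weight I) (state_at d I C t) (live I C t)"

lemma finite_events:
  assumes "finite (jobs I)"
  shows "finite (events I C)"
proof (rule finite_subset)
  show "events I C \<subseteq> release I ` jobs I \<union> (\<lambda>j. real_of_ereal (C j)) ` jobs I"
    unfolding events_def by force
qed (use assms in simp)

lemma set_past: "finite (jobs I) \<Longrightarrow> set (past I C t) = events I C \<inter> {..t}"
  by (simp add: past_def finite_events)

lemma past_append:
  assumes "finite (jobs I)" "t \<le> t'"
  obtains zs where "past I C t' = zs @ past I C t" "set zs = events I C \<inter> {t<..t'}"
proof
  let ?E = "events I C"
  let ?zs = "rev (sorted_list_of_set (?E \<inter> {t<..t'}))"
  have f: "finite (?E \<inter> X)" for X using finite_events[OF assms(1)] by simp
  show "set ?zs = ?E \<inter> {t<..t'}" using f by simp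
  have "sorted_list_of_set (?E \<inter> {..t'}) =
      sorted_list_of_set (?E \<inter> {..t}) @ sorted_list_of_set (?E \<inter> {t<..t'})"
  proof (rule sorted_distinct_set_unique)
    show "set (sorted_list_of_set (?E \<inter> {..t'})) =
      set (sorted_list_of_set (?E \<inter> {..t}) @ sorted_list_of_set (?E \<inter> {t<..t'}))"
      using f assms(2) by auto
  qed (use f in \<open>auto simp: sorted_append\<close>)
  then show "past I C t' = ?zs @ past I C t" by (simp add: past_def)
qed

text \<open>Guesses that differ only after \<open>t\<close> have the same events up to
  \<open>t\<close> and the same live sets at these events, hence lead to the same
  simulation.\<close>

lemma sched_cong:
  assumes fin: "finite (jobs I)"
    and "\<And>j. j \<in> jobs I \<Longrightarrow> C1 j = C2 j \<or> ereal t < C1 j \<and> ereal t < C2 j"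
  shows "sched d s N I C1 t = sched d s N I C2 t"
proof -
  have iff: "ereal e < C1 j \<longleftrightarrow> ereal e < C2 j" if "e \<le> t" "j \<in> jobs I" for e j
    using assms(2)[OF that(2)] that(1) le_less_trans[of "ereal e" "ereal t"] by auto
  have iff': "C1 j = ereal e \<longleftrightarrow> C2 j = ereal e" if "e \<le> t" "j \<in> jobs I" for e j
    using assms(2)[OF that(2)] that(1) by auto
  have L: "live I C1 e = live I C2 e" if "e \<le> t" for e
    unfolding live_def using iff[OF that] by auto
  have "events I C1 \<inter> {..t} = events I C2 \<inter> {..t}"
    unfolding events_def using iff' by auto
  then have P: "past I C1 t = past I C2 t" by (simp add: past_def)
  have "sim d (weight I) (masked_rate I) (machines I) (live I C1) (past I C2 t) =
      sim d (weight I) (masked_rate I) (machines I) (live I C2) (past I C2 t)"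
    using L set_past[OF fin, of C2 t] by (intro sim_cong) auto
  then show ?thesis
    unfolding sched_def state_at_def P by (simp add: L)
qed

text \<open>Facts that hold for every guess \<open>C\<close>, before it is known to be consistent
  with the schedule; they are needed to construct the fixed point. The bound on \<open>C\<close>
  also excludes the value minus infinity.\<close>

locale run =
  fixes d s :: real and N :: nat and I :: sched_instance and C :: "nat \<Rightarrow> ereal"
  assumes d: "0 \<le> d" and s: "0 \<le> s" and N: "0 < N" and valid: "valid_instance I"
    and C: "\<And>j. j \<in> jobs I \<Longrightarrow> ereal (release I j) \<le> C j"
begin

abbreviation "w \<equiv> weight I"
abbreviation "l \<equiv> masked_rate I"
abbreviation "m \<equiv> machines I"
abbreviation "A \<equiv> live I C"
abbreviation "S \<equiv> state_at d I C"
abbreviation "es \<equiv> past I C"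
abbreviation "U t j \<equiv> delay w l (S t) (A t) j"
abbreviation "\<nu> t j \<equiv> share s N w (S t) (A t) j"

lemma finite_jobs: "finite (jobs I)" using valid by (simp add: valid_instance_def)

lemma live: "finite (A t)" "j \<in> A t \<Longrightarrow> 0 < w j" "j \<in> A t \<Longrightarrow> \<exists>i<m. 0 < l i j"
  using valid by (auto simp: live_def valid_instance_def masked_rate_def)

text \<open>No release and no completion lies strictly between the last event and \<open>t\<close>,
  so the live set has not changed since then.\<close>

lemma latest_past: "latest A (es t) = A t"
proof (cases "events I C \<inter> {..t} = {}")
  case True
  then have "A t = {}" by (auto simp: live_def events_def)
  then show ?thesis using True by (simp add: past_def latest_def)
next
  case False
  let ?E = "events I C \<inter> {..t}"
  have f: "finite ?E" using finite_events[OF finite_jobs] by simp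
  obtain e zs where e: "es t = e # zs"
    using False f unfolding past_def by (cases "rev (sorted_list_of_set ?E)") auto
  have "sorted (rev zs @ [e])"
    using sorted_sorted_list_of_set[of ?E] e unfolding past_def by (metis rev.simps(2) rev_rev_ident)
  then have max: "e' \<le> e" if "e' \<in> ?E" for e'
    using set_past[OF finite_jobs, of C t] e that by (auto simp: sorted_append)
  have eE: "e \<in> ?E" using set_past[OF finite_jobs, of C t] e by (metis list.set_intros(1))
  have "A e = A t"
  proof -
    have "release I j \<le> e \<longleftrightarrow> release I j \<le> t" if "j \<in> jobs I" for j
      using max[of "release I j"] that eE by (auto simp: events_def)
    moreover have "ereal e < C j \<longleftrightarrow> ereal t < C j" if "j \<in> jobs I" for j
    proof (cases "C j")
      case (real c)
      then show ?thesis using max[of c] that eE by (force simp: events_def not_le[symmetric])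
    qed (use C[OF that] in auto)
    ultimately show ?thesis by (auto simp: live_def)
  qed
  then show ?thesis using e by (simp add: latest_def)
qed

lemma assignable: "assignable l m (S t) (A t)"
  using sim_assignable[of d A w m l "es t", OF d live] by (simp add: state_at_def latest_past)

lemma inj_rank: "inj_on (\<lambda>j. snd (S t j)) (A t)"
  and machine_lt: "j \<in> A t \<Longrightarrow> fst (S t j) < m"
  and rate_pos: "j \<in> A t \<Longrightarrow> 0 < l (fst (S t j)) j"
  using assignable by (auto simp: assignable_def)

lemma equilibrium:
  assumes "j \<in> A t" "i < m" "0 < l i j"
  shows "U t j \<le> (1 + d) * (load w (S t) (A t) i + w j) / l i j"
proof (cases "es t")
  case Nil
  then show ?thesis using latest_past[of t] assms by (simp add: latest_def)
next
  case (Cons e zs)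
  then have "A e = A t" using latest_past[of t] by (simp add: latest_def)
  then show ?thesis
    using sim_settled[of d A w m l zs e, OF d live] assms Cons
    unfolding settled_def equilibrium_def state_at_def by simp
qed

lemma U_nonneg: "j \<in> A t \<Longrightarrow> 0 \<le> U t j"
  using sim_delay_nonneg[of d A w m l j "es t", OF d live] by (simp add: state_at_def latest_past)

text \<open>The times at which a job is live form an interval, so a job live at \<open>t\<close> and
  \<open>t'\<close> is live at all events in between and \<open>sim_delay_mono\<close> applies. Both
  the charging argument and the migration bound rest on this.\<close>

lemma U_mono:
  assumes "t \<le> t'" "j \<in> A t" "j \<in> A t'"
  shows "U t' j \<le> U t j" "fst (S t' j) \<noteq> fst (S t j) \<Longrightarrow> (1 + d) * U t' j < U t j"
proof -
  obtain zs where zs: "es t' = zs @ es t" "set zs = events I C \<inter> {t<..t'}"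
    by (rule past_append[OF finite_jobs assms(1)])
  have "j \<in> A e" if "e \<in> set zs" for e
  proof -
    have "ereal t' < C j" using assms(3) by (simp add: live_def)
    then have "ereal e < C j" using that zs(2) by (auto intro: le_less_trans[of _ "ereal t'"])
    then show ?thesis using that assms zs(2) by (auto simp: live_def)
  qed
  from sim_delay_mono[of d A w m l j "es t" zs, OF d live _ this] assms(2)
  show "U t' j \<le> U t j" "fst (S t' j) \<noteq> fst (S t j) \<Longrightarrow> (1 + d) * U t' j < U t j"
    using latest_past[of t'] by (simp_all add: state_at_def latest_past zs(1))
qed

text \<open>State and live set at \<open>t\<close> are functions of the finite set of events up to
  \<open>t\<close>.\<close>

lemma stepwise_integrable:
  fixes h :: "qstate \<Rightarrow> nat set \<Rightarrow> real"
  shows "(\<lambda>t. h (S t) (A t)) integrable_on {a..b}"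
proof -
  define g where "g X = (let xs = rev (sorted_list_of_set X) in h (sim d w l m A xs) (latest A xs))" for X
  have "(\<lambda>t. g (events I C \<inter> {..t})) integrable_on {a..b}"
    by (rule integrable_stepwise[OF finite_events[OF finite_jobs], of g])
  moreover have "g (events I C \<inter> {..t}) = h (S t) (A t)" for t
    using latest_past[of t] by (simp add: g_def state_at_def past_def Let_def)
  ultimately show ?thesis by simp
qed

lemma share_nonneg_at: "j \<in> A t \<Longrightarrow> 0 \<le> \<nu> t j"
  by (rule share_nonneg) (use live inj_rank N s in auto)

lemma ahead_bounds_at:
  assumes "j \<in> A t"
  shows "w j \<le> sum w (ahead (S t) (A t) j)"
    "sum w (ahead (S t) (A t) j) \<le> load w (S t) (A t) (fst (S t j))"
  by (rule ahead_bounds[where s = s and N = N]; use live inj_rank N s assms in auto)+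

lemma share_ahead_le_at: "j \<in> A t \<Longrightarrow> \<nu> t j * sum w (ahead (S t) (A t) j) \<le> s * real N * w j"
  by (rule share_ahead_le) (use live inj_rank N s in auto)

lemma sum_share_machine_at: "(\<Sum>j | j \<in> A t \<and> fst (S t j) = i. \<nu> t j) \<le> s"
  by (rule sum_share_machine(1)) (use live inj_rank N s in auto)

lemma sum_share_total_at:
  "s * (real N / real (Suc N)) * sum w (A t) \<le> (\<Sum>j\<in>A t. \<nu> t j * sum w (ahead (S t) (A t) j))"
  by (rule sum_share_total[where m = m]) (use live inj_rank N s machine_lt in auto)

lemma proc_rate_sched:
  "proc_rate I (sched d s N I C) j t = (if j \<in> A t then l (fst (S t j)) j * \<nu> t j else 0)"
  using machine_lt[of j t] by (simp add: proc_rate_def sched_def decide_def masked_rate_def)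

lemma proc_rate_sched_nonneg: "0 \<le> proc_rate I (sched d s N I C) j t"
proof (cases "j \<in> A t")
  case True
  then show ?thesis
    using rate_pos[OF True] share_nonneg_at[OF True] by (simp add: proc_rate_sched)
qed (simp add: proc_rate_sched)

lemma proc_rate_sched_integrable: "proc_rate I (sched d s N I C) j integrable_on {a..b}"
proof -
  have "(\<lambda>t. if j \<in> A t then l (fst (S t j)) j * \<nu> t j else 0) integrable_on {a..b}"
    by (rule stepwise_integrable[of "\<lambda>S A. if j \<in> A then l (fst (S j)) j * share s N w S A j else 0"])
  then show ?thesis unfolding proc_rate_sched .
qed

end

section \<open>Existence of the generated schedule\<close>

lemma completion_eq_finish:
  "completion I \<sigma> j = finish (release I j) (len I j) (proc_rate I \<sigma> j)"
  by (simp add: completion_def finish_def)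

lemma release_le_completion: "ereal (release I j) \<le> completion I \<sigma> j"
  unfolding completion_def by (intro Inf_greatest) auto

lemma decide_cong:
  assumes "\<And>j. j \<in> A \<Longrightarrow> w1 j = w2 j"
  shows "decide s N w1 S A = decide s N w2 S A"
proof
  fix j
  have 1: "sum w1 (ahead S A j) = sum w2 (ahead S A j)"
    using assms by (intro sum.cong) (auto simp: ahead_def)
  have 2: "load w1 S A i = load w2 S A i" for i
    unfolding load_def using assms by (intro sum.cong) auto
  show "decide s N w1 S A j = decide s N w2 S A j"
    using assms by (simp add: decide_def share_def 1 2)
qed

text \<open>When the guess is the true vector of completion times, an observation at
  \<open>t\<close> contains all data that \<open>sched\<close> uses at \<open>t\<close>: every event
  up to \<open>t\<close> and the weights and rates of the jobs present at these events.\<close>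

lemma migrate_alg_observe:
  assumes "run d s N I (completion I \<sigma>)"
  shows "migrate_alg d s N (observe I \<sigma> t) = sched d s N I (completion I \<sigma>) t"
proof -
  interpret run d s N I "completion I \<sigma>" by (rule assms)
  let ?C = "completion I \<sigma>"
  define obs where "obs = observe I \<sigma> t"
  define w' where "w' = (\<lambda>j. info_weight (the (obs_arrived obs j)))"
  define l' where "l' = (\<lambda>i j. info_rate (the (obs_arrived obs j)) i)"
  define L' where "L' = (\<lambda>e. {j. \<exists>x. obs_arrived obs j = Some x \<and> info_release x \<le> e \<and>
                (\<exists>i<obs_machines obs. 0 < info_rate x i) \<and>
                \<not> (\<exists>c. obs_completed obs j = Some c \<and> c \<le> e)})"
  define es' where "es' = rev (sorted_list_of_set
                ({info_release x |x j. obs_arrived obs j = Some x} \<union>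
                 {c |c j. obs_completed obs j = Some c}))"
  have alg: "migrate_alg d s N obs =
      decide s N w' (sim d w' l' (obs_machines obs) L' es') (latest L' es')"
    unfolding migrate_alg_def w'_def l'_def L'_def es'_def Let_def ..
  have arr: "obs_arrived obs j = Some x \<longleftrightarrow> j \<in> jobs I \<and> release I j \<le> t \<and>
      x = \<lparr>info_release = release I j, info_weight = w j, info_rate = \<lambda>i. l i j\<rparr>" for j x
    by (auto simp: obs_def observe_def masked_rate_def)
  have comp: "obs_completed obs j = Some c \<longleftrightarrow> j \<in> jobs I \<and> ?C j = ereal c \<and> c \<le> t" for j c
    using release_le_completion[of I j \<sigma>]
    by (cases "?C j") (auto simp: obs_def observe_def)
  have m: "obs_machines obs = m" by (simp add: obs_def observe_def)
  have "{info_release x |x j. obs_arrived obs j = Some x} = release I ` {j \<in> jobs I. release I j \<le> t}"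
  proof (intro equalityI subsetI)
    fix r assume "r \<in> release I ` {j \<in> jobs I. release I j \<le> t}"
    then obtain j where "r = release I j"
      "obs_arrived obs j = Some \<lparr>info_release = release I j, info_weight = w j, info_rate = \<lambda>i. l i j\<rparr>"
      unfolding arr by auto
    then show "r \<in> {info_release x |x j. obs_arrived obs j = Some x}"
      by (metis (mono_tags, lifting) job_info.select_convs(1) mem_Collect_eq)
  qed (auto simp: arr)
  moreover have "{c |c j. obs_completed obs j = Some c} = {c. c \<le> t \<and> (\<exists>j\<in>jobs I. ?C j = ereal c)}"
    by (auto simp: comp)
  ultimately have "{info_release x |x j. obs_arrived obs j = Some x} \<union>
      {c |c j. obs_completed obs j = Some c} = events I ?C \<inter> {..t}"
    by (auto simp: events_def)
  then have es': "es' = es t" by (simp add: es'_def past_def)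
  have L': "L' e = A e" if "e \<le> t" for e
  proof -
    have "ereal e < ?C j \<longleftrightarrow> \<not> (\<exists>c. obs_completed obs j = Some c \<and> c \<le> e)" if "j \<in> jobs I" for j
      using release_le_completion[of I j \<sigma>] that \<open>e \<le> t\<close>
      by (cases "?C j") (auto simp: comp)
    then show ?thesis using that by (auto simp: L'_def live_def arr m masked_rate_def)
  qed
  have es_le: "e \<le> t" if "e \<in> set (es t)" for e
    using that by (simp add: set_past[OF finite_jobs])
  have wl: "w' j = w j" "l' i j = l i j" if "j \<in> A e" "e \<le> t" for i j e
  proof -
    have "obs_arrived obs j =
        Some \<lparr>info_release = release I j, info_weight = w j, info_rate = \<lambda>i. l i j\<rparr>"
      unfolding arr using that by (auto simp: live_def)
    then show "w' j = w j" "l' i j = l i j" by (simp_all add: w'_def l'_def)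
  qed
  have "sim d w' l' m L' (es t) = S t"
    unfolding state_at_def using L' wl es_le by (intro sim_cong) blast+
  moreover have "latest L' (es t) = A t"
    using L' es_le latest_past[of t] by (cases "es t") (auto simp: latest_def)
  moreover have "decide s N w' (S t) (A t) = decide s N w (S t) (A t)"
    using wl by (intro decide_cong) blast
  ultimately show ?thesis
    unfolding obs_def[symmetric] alg m es' sched_def by simp
qed

text \<open>Every generated schedule, and not only the constructed one, has this form, so the
  analysis of \<open>sched\<close> covers them all.\<close>

lemma generates_eq_sched:
  assumes "generates (migrate_alg d s N) I \<sigma>" "0 \<le> d" "0 \<le> s" "0 < N" "valid_instance I"
  shows "run d s N I (completion I \<sigma>)" "\<sigma> = sched d s N I (completion I \<sigma>)"
proof -
  show run: "run d s N I (completion I \<sigma>)"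
    using assms release_le_completion by unfold_locales auto
  show "\<sigma> = sched d s N I (completion I \<sigma>)"
    using assms(1) migrate_alg_observe[OF run] unfolding generates_def by auto
qed

context run
begin

abbreviation "\<sigma> \<equiv> sched d s N I C"

lemmas proc_facts = proc_rate_sched_integrable proc_rate_sched_nonneg

lemma len_pos: "j \<in> jobs I \<Longrightarrow> 0 < len I j"
  using valid by (simp add: valid_instance_def)

end

text \<open>A prefix of the schedule up to time \<open>\<tau>\<close> only depends on the completions before \<open>\<tau>\<close>, so the
  completion times are found one at a time, in increasing order.\<close>

lemma fixpoint_exists:
  assumes par: "0 \<le> d" "0 \<le> s" "0 < N" and valid: "valid_instance I"
  shows "\<exists>C. \<forall>j\<in>jobs I. C j = completion I (sched d s N I C) j"
proof -
  let ?cpl = "\<lambda>C j. completion I (sched d s N I C) j"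
  \<comment> \<open>The jobs in \<open>D\<close> have their final completion times, all at most
    \<tau>. The others carry the provisional value infinity, and under the present guess none of
    them completes before \<tau>.\<close>
  define inv where "inv C D \<tau> \<longleftrightarrow> D \<subseteq> jobs I \<and> (\<forall>j\<in>D. C j = ?cpl C j \<and> C j \<le> ereal \<tau>) \<and>
     (\<forall>j\<in>jobs I - D. C j = \<infinity> \<and> ereal \<tau> \<le> ?cpl C j)" for C D and \<tau> :: real
  have fin: "finite (jobs I)" using valid by (simp add: valid_instance_def)
  have run: "run d s N I C" if "inv C D \<tau>" for C D \<tau>
  proof
    show "ereal (release I j) \<le> C j" if "j \<in> jobs I" for j
      using that \<open>inv C D \<tau>\<close> release_le_completion[of I j] unfolding inv_def
      by (cases "j \<in> D") auto
  qed (use par valid in auto)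
  have "\<exists>C. \<forall>j\<in>jobs I. C j = ?cpl C j" if "inv C D \<tau>" for C D \<tau>
    using that
  proof (induction "card (jobs I - D)" arbitrary: C D \<tau> rule: less_induct)
    case less
    show ?case
    proof (cases "\<forall>j\<in>jobs I - D. ?cpl C j = \<infinity>")
      case True
      then show ?thesis using less.prems unfolding inv_def by (metis Diff_iff)
    next
      case False
      define X where "X = ?cpl C ` (jobs I - D)"
      have X: "finite X" "X \<noteq> {}" using fin False by (auto simp: X_def)
      have "Min X \<noteq> \<infinity>"
      proof
        assume "Min X = \<infinity>"
        then have "x = \<infinity>" if "x \<in> X" for x using Min_le[OF X(1) that] by simp
        then show False using False by (auto simp: X_def)
      qed
      moreover have "ereal \<tau> \<le> Min X"
        using less.prems X by (auto simp: inv_def X_def)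
      ultimately obtain \<tau>' where \<tau>': "Min X = ereal \<tau>'" "\<tau> \<le> \<tau>'" by (cases "Min X") auto
      have min: "ereal \<tau>' \<le> ?cpl C j" if "j \<in> jobs I - D" for j
        using Min_le[OF X(1)] that \<tau>'(1) by (auto simp: X_def)
      define D1 where "D1 = {j \<in> jobs I - D. ?cpl C j = ereal \<tau>'}"
      have "D1 \<noteq> {}" using Min_in[OF X] \<tau>'(1) by (auto simp: D1_def X_def)
      \<comment> \<open>All jobs that complete at the next completion time under the present guess
        are fixed at once. The guess changes only from infinity to that time, so the schedules agree
        before it.\<close>
      define C' where "C' j = (if j \<in> D1 then ereal \<tau>' else C j)" for j
      have eq: "sched d s N I C t = sched d s N I C' t" if "t < \<tau>'" for t
        by (rule sched_cong[OF fin])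
          (use that less.prems in \<open>auto simp: C'_def D1_def inv_def\<close>)
      have "run d s N I C'"
      proof
        show "ereal (release I j) \<le> C' j" if "j \<in> jobs I" for j
          using that run.C[OF run[OF less.prems] that] release_le_completion[of I j "sched d s N I C"]
          by (auto simp: C'_def D1_def)
      qed (use par valid in auto)
      note f = run.proc_facts[OF run[OF less.prems]] and g = run.proc_facts[OF this]
      have cong: "?cpl C j \<le> ereal \<tau>' \<Longrightarrow> ?cpl C' j = ?cpl C j"
        "ereal \<tau>' \<le> ?cpl C j \<Longrightarrow> ereal \<tau>' \<le> ?cpl C' j" if "j \<in> jobs I" for j
      proof -
        have p: "0 < len I j" using valid that by (simp add: valid_instance_def)
        have e: "proc_rate I (sched d s N I C) j t = proc_rate I (sched d s N I C') j t"
          if "t < \<tau>'" for t using eq[OF that] by (simp add: proc_rate_def)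
        show "?cpl C j \<le> ereal \<tau>' \<Longrightarrow> ?cpl C' j = ?cpl C j"
          "ereal \<tau>' \<le> ?cpl C j \<Longrightarrow> ereal \<tau>' \<le> ?cpl C' j"
          unfolding completion_eq_finish using finish_cong[OF f g p e] by blast+
      qed
      have "inv C' (D \<union> D1) \<tau>'"
        unfolding inv_def
      proof (intro conjI ballI)
        show "D \<union> D1 \<subseteq> jobs I" using less.prems by (auto simp: inv_def D1_def)
      next
        fix j assume j: "j \<in> D \<union> D1"
        then have jI: "j \<in> jobs I" using less.prems by (auto simp: inv_def D1_def)
        have C'j: "C' j = ?cpl C j" "C' j \<le> ereal \<tau>'"
          using j less.prems \<tau>'(2) order_trans[of "C j" "ereal \<tau>" "ereal \<tau>'"]
          by (auto simp: C'_def D1_def inv_def)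
        then show "C' j = ?cpl C' j" "C' j \<le> ereal \<tau>'" using cong(1)[OF jI] by auto
      next
        fix j assume j: "j \<in> jobs I - (D \<union> D1)"
        then show "C' j = \<infinity>" "ereal \<tau>' \<le> ?cpl C' j"
          using less.prems min[of j] cong(2)[of j] by (auto simp: C'_def inv_def)
      qed
      moreover have "card (jobs I - (D \<union> D1)) < card (jobs I - D)"
        using fin \<open>D1 \<noteq> {}\<close> by (intro psubset_card_mono) (auto simp: D1_def)
      ultimately show ?thesis using less.hyps by blast
    qed
  qed
  \<comment> \<open>Initially nothing is fixed, and no job completes before the earliest
    release.\<close>
  moreover have "inv (\<lambda>_. \<infinity>) {} (Min (release I ` jobs I))"
    unfolding inv_def using fin release_le_completion
    by (auto intro!: order_trans[OF _ release_le_completion])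
  ultimately show ?thesis by blast
qed

lemma generates_exists:
  assumes par: "0 \<le> d" "0 \<le> s" "0 < N" and valid: "valid_instance I"
  shows "\<exists>\<sigma>. generates (migrate_alg d s N) I \<sigma>"
proof -
  obtain C where C: "\<forall>j\<in>jobs I. C j = completion I (sched d s N I C) j"
    using fixpoint_exists[OF assms] by blast
  let ?\<sigma> = "sched d s N I C"
  have run: "run d s N I (completion I ?\<sigma>)"
    using assms release_le_completion by unfold_locales auto
  have "finite (jobs I)" using valid by (simp add: valid_instance_def)
  then have "sched d s N I (completion I ?\<sigma>) t = ?\<sigma> t" for t
    using C by (intro sched_cong) auto
  then show ?thesis
    unfolding generates_def using migrate_alg_observe[OF run] by metis
qed

section \<open>Dual fitting\<close>

text \<open>The rate vanishes before \<open>r\<close> and from the completion on, and in between it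
  integrates to \<open>p\<close> by \<open>finish_cases\<close>; without completion every integral
  stays below \<open>p\<close>.\<close>

lemma integral_finish_total:
  assumes int: "\<And>a b. f integrable_on {a..b}" and nn: "\<And>t. 0 \<le> f t" and p: "0 < p"
    and zero: "\<And>t. t < r \<or> finish r p f \<le> ereal t \<Longrightarrow> f t = 0"
  shows "integral {a..b} f \<le> p"
    and "finish r p f = ereal c \<Longrightarrow> a \<le> r \<Longrightarrow> c \<le> b \<Longrightarrow> integral {a..b} f = p"
proof -
  have before: "integral {x..r} f = 0" for x
    using integral_spike[of "{r}" "{x..r}" f "\<lambda>_. 0"] by (auto simp: zero)
  have after: "integral {c..x} f = 0" if "finish r p f = ereal c" for c x
    using integral_cong[of "{c..x}" f "\<lambda>_. 0"] by (auto simp: zero that)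
  have full: "integral {x..y} f = p"
    if c: "finish r p f = ereal c" and "x \<le> r" "c \<le> y" for c x y
  proof -
    have rc: "r < c" "integral {r..c} f = p"
      using c by (cases rule: finish_cases[OF int nn p, of r]; auto)+
    have "integral {x..y} f = integral {x..r} f + integral {r..y} f"
      using that rc(1) by (intro Henstock_Kurzweil_Integration.integral_combine[symmetric] int) auto
    also have "integral {r..y} f = integral {r..c} f + integral {c..y} f"
      using that rc(1) by (intro Henstock_Kurzweil_Integration.integral_combine[symmetric] int) auto
    finally show ?thesis using before after[OF c] rc(2) by simp
  qed
  then show "finish r p f = ereal c \<Longrightarrow> a \<le> r \<Longrightarrow> c \<le> b \<Longrightarrow> integral {a..b} f = p" by blast
  show "integral {a..b} f \<le> p"
  proof (cases rule: finish_cases[OF int nn p, of r])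
    case 1
    have "integral {a..b} f \<le> integral {min a r..max b r} f"
      by (intro integral_subset_le int) (auto simp: nn)
    also have "\<dots> = integral {min a r..r} f + integral {r..max b r} f"
      by (intro Henstock_Kurzweil_Integration.integral_combine[symmetric] int) auto
    also have "\<dots> \<le> p" using before 1(2)[of "max b r"] by simp
    finally show ?thesis .
  next
    case (2 c)
    have "integral {a..b} f \<le> integral {min a r..max b c} f"
      by (intro integral_subset_le int) (auto simp: nn)
    also have "\<dots> = p" using 2(1) by (intro full) auto
    finally show ?thesis by simp
  qed
qed

lemma has_integral_window:
  fixes r x a b v :: real
  assumes "a \<le> r" "r \<le> x" "x \<le> b"
  shows "((\<lambda>t. if r \<le> t \<and> t < x then v else 0) has_integral v * (x - r)) {a..b}"
proof (rule has_integral_spike[of "{x}"])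
  have "((\<lambda>_. v) has_integral v * (x - r)) {r..x}"
    using has_integral_const_real[of v r x] assms by (simp add: mult.commute)
  then show "((\<lambda>t. if t \<in> {r..x} then v else 0) has_integral v * (x - r)) {a..b}"
    using assms by (subst has_integral_restrict) auto
qed auto

lemma feasible_proc_rate:
  assumes "valid_instance I" "feasible s I \<tau>" "j \<in> jobs I"
  shows "proc_rate I \<tau> j integrable_on {a..b}" "0 \<le> proc_rate I \<tau> j t"
    "t < release I j \<or> completion I \<tau> j \<le> ereal t \<Longrightarrow> proc_rate I \<tau> j t = 0"
proof -
  show "proc_rate I \<tau> j integrable_on {a..b}" using assms by (simp add: feasible_def)
  have al: "alive I \<tau> j t \<and> i < machines I \<and> 0 \<le> v" if "\<tau> t j = Some (i, v)" for i v
    using assms(2) that by (auto simp: feasible_def)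
  show "0 \<le> proc_rate I \<tau> j t"
  proof (cases "\<tau> t j")
    case (Some x)
    then show ?thesis using al[of "fst x" "snd x"] assms(1,3)
      by (auto simp: proc_rate_def valid_instance_def split: prod.split)
  qed (simp add: proc_rate_def)
  show "proc_rate I \<tau> j t = 0" if "t < release I j \<or> completion I \<tau> j \<le> ereal t"
  proof (cases "\<tau> t j")
    case (Some x)
    then show ?thesis using al[of "fst x" "snd x"] that by (auto simp: alive_def)
  qed (simp add: proc_rate_def)
qed

lemma feasible_processed:
  assumes "valid_instance I" "feasible s I \<tau>" "j \<in> jobs I"
  shows "integral {a..b} (proc_rate I \<tau> j) \<le> len I j"
    and "completion I \<tau> j = ereal c \<Longrightarrow> a \<le> release I j \<Longrightarrow> c \<le> b \<Longrightarrow>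
      integral {a..b} (proc_rate I \<tau> j) = len I j"
proof -
  have p: "0 < len I j" using assms by (simp add: valid_instance_def)
  note f = feasible_proc_rate[OF assms]
  show "integral {a..b} (proc_rate I \<tau> j) \<le> len I j"
    by (rule integral_finish_total(1)[of _ _ "release I j"])
      (use f p in \<open>auto simp: completion_eq_finish\<close>)
  show "completion I \<tau> j = ereal c \<Longrightarrow> a \<le> release I j \<Longrightarrow> c \<le> b \<Longrightarrow>
      integral {a..b} (proc_rate I \<tau> j) = len I j"
    by (rule integral_finish_total(2)[of _ _ "release I j"])
      (use f p in \<open>auto simp: completion_eq_finish\<close>)
qed

text \<open>From here on the guess is consistent, so live jobs are alive in the sense of
  \<open>feasible\<close>.\<close>

locale online_run = run +
  assumes completion_eq: "j \<in> jobs I \<Longrightarrow> C j = completion I \<sigma> j"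
begin

lemma feasible_sched: "feasible s I \<sigma>"
  unfolding feasible_def
proof (intro conjI allI impI ballI)
  fix t j i v assume "\<sigma> t j = Some (i, v)"
  then have j: "j \<in> A t" "i = fst (S t j)" "v = \<nu> t j"
    by (auto simp: sched_def decide_def split: if_splits)
  then show "alive I \<sigma> j t" using completion_eq by (auto simp: alive_def live_def)
  show "i < m" using machine_lt j by simp
  show "0 \<le> v" using share_nonneg_at[OF j(1)] j(3) by simp
next
  fix t i assume "i < m"
  have "(\<Sum>j | j \<in> jobs I \<and> machine_of \<sigma> j t = Some i. share_of \<sigma> j t)
      = (\<Sum>j | j \<in> A t \<and> fst (S t j) = i. \<nu> t j)"
    by (rule sum.cong)
      (auto simp: machine_of_def share_of_def sched_def decide_def live_def split: if_splits)
  then show "(\<Sum>j | j \<in> jobs I \<and> machine_of \<sigma> j t = Some i. share_of \<sigma> j t) \<le> s"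
    using sum_share_machine_at by simp
next
  fix j a b show "proc_rate I \<sigma> j integrable_on {a..b}" by (rule proc_rate_sched_integrable)
qed

definition charge :: "nat \<Rightarrow> real \<Rightarrow> real" where
  "charge j t = (if j \<in> A t then \<nu> t j * sum w (ahead (S t) (A t) j) else 0)"

lemma charge_integrable: "charge j integrable_on {a..b}"
proof -
  have "(\<lambda>t. if j \<in> A t then \<nu> t j * sum w (ahead (S t) (A t) j) else 0) integrable_on {a..b}"
    by (rule stepwise_integrable[of "\<lambda>S A. if j \<in> A then share s N w S A j * sum w (ahead S A j) else 0"])
  then show ?thesis unfolding charge_def .
qed

lemma charge_nonneg: "0 \<le> charge j t"
proof (cases "j \<in> A t")
  case True
  have "0 \<le> sum w (ahead (S t) (A t) j)"
    using ahead_bounds_at(1)[OF True] live(2)[OF True] by linarith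
  then show ?thesis using share_nonneg_at[OF True] by (simp add: charge_def)
qed (simp add: charge_def)

lemma charge_le: "j \<in> jobs I \<Longrightarrow> charge j t \<le> s * real N * w j"
  using share_ahead_le_at[of j t] s valid
  by (auto simp: charge_def valid_instance_def less_imp_le)

text \<open>The machine's rate cancels: the charge is the current delay times the current processing
  rate, and the delay has not grown since \<open>t0\<close>.\<close>

lemma charge_le_delay:
  assumes "j \<in> A t0" "t0 \<le> t"
  shows "charge j t \<le> U t0 j * proc_rate I \<sigma> j t"
proof (cases "j \<in> A t")
  case True
  have "charge j t = U t j * proc_rate I \<sigma> j t"
    using True rate_pos[OF True] by (simp add: charge_def proc_rate_sched delay_def)
  also have "\<dots> \<le> U t0 j * proc_rate I \<sigma> j t"
    using U_mono(1)[OF assms(2,1) True] proc_rate_sched_nonneg by (intro mult_right_mono)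
  finally show ?thesis .
qed (simp add: charge_def proc_rate_sched)

text \<open>The charge is cut at \<open>t\<close>: before, it accrues at a bounded rate; after, it
  is at most the delay at \<open>t\<close> times the work done on \<open>j\<close>, which never
  exceeds its length. For a horizon \<open>T < t\<close> the second part is absent.\<close>

lemma total_charge_le:
  assumes j: "j \<in> jobs I" and a: "a \<le> release I j" "release I j \<le> t"
  shows "integral {a..T} (charge j) \<le> s * real N * w j * (t - release I j)
    + (if t \<le> T \<and> j \<in> A t then U t j * len I j else 0)"
proof -
  let ?r = "release I j"
  have "integral {a..t} (charge j) = integral {a..?r} (charge j) + integral {?r..t} (charge j)"
    using a by (intro Henstock_Kurzweil_Integration.integral_combine[symmetric] charge_integrable) auto
  also have "integral {a..?r} (charge j) = 0"
    using integral_spike[of "{?r}" "{a..?r}" "charge j" "\<lambda>_. 0"]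
    by (auto simp: charge_def live_def)
  also have "integral {?r..t} (charge j) \<le> integral {?r..t} (\<lambda>_. s * real N * w j)"
    using charge_le[OF j] by (intro integral_le charge_integrable) auto
  finally have first: "integral {a..t} (charge j) \<le> s * real N * w j * (t - ?r)"
    using a by (simp add: mult_ac)
  show ?thesis
  proof (cases "t \<le> T")
    case False
    then have "integral {a..T} (charge j) \<le> integral {a..t} (charge j)"
      using a by (intro integral_subset_le charge_integrable) (auto simp: charge_nonneg)
    then show ?thesis using first False by simp
  next
    case True
    have "integral {t..T} (charge j) \<le> (if j \<in> A t then U t j * len I j else 0)"
    proof (cases "j \<in> A t")
      case jt: True
      have "integral {t..T} (charge j) \<le> integral {t..T} (\<lambda>x. U t j * proc_rate I \<sigma> j x)"
        using charge_le_delay[OF jt] integrable_on_mult_right[OF proc_rate_sched_integrable]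
        by (intro integral_le charge_integrable) auto
      also have "\<dots> = U t j * integral {t..T} (proc_rate I \<sigma> j)" by simp
      also have "\<dots> \<le> U t j * len I j"
        using feasible_processed(1)[OF valid feasible_sched j] U_nonneg[OF jt]
        by (intro mult_left_mono)
      finally show ?thesis using jt by simp
    next
      case jt: False
      \<comment> \<open>Since \<open>t\<close> is past the release, absence at \<open>t\<close> is
        permanent.\<close>
      have "charge j x = 0" if "t \<le> x" for x
        using jt that a(2) j by (auto simp: charge_def live_def intro: le_less_trans[of _ "ereal x"])
      then have "integral {t..T} (charge j) = integral {t..T} (\<lambda>_. 0)"
        by (intro integral_cong) auto
      then show ?thesis using jt by simp
    qed
    moreover have "integral {a..T} (charge j) = integral {a..t} (charge j) + integral {t..T} (charge j)"
      using a True by (intro Henstock_Kurzweil_Integration.integral_combine[symmetric] charge_integrable) auto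
    ultimately show ?thesis using first True by simp
  qed
qed

lemma backlog_integrable: "(\<lambda>t. sum w (A t)) integrable_on {a..b}"
  by (rule stepwise_integrable[of "\<lambda>S A. sum w A"])

lemma backlog_le_charges:
  "s * (real N / real (Suc N)) * integral {a..T} (\<lambda>t. sum w (A t))
    \<le> (\<Sum>j\<in>jobs I. integral {a..T} (charge j))"
proof -
  have "s * (real N / real (Suc N)) * integral {a..T} (\<lambda>t. sum w (A t))
      = integral {a..T} (\<lambda>t. s * (real N / real (Suc N)) * sum w (A t))" by simp
  also have "\<dots> \<le> integral {a..T} (\<lambda>t. \<Sum>j\<in>jobs I. charge j t)"
  proof (intro integral_le integrable_sum finite_jobs charge_integrable)
    show "(\<lambda>t. s * (real N / real (Suc N)) * sum w (A t)) integrable_on {a..T}"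
      by (rule integrable_on_mult_right[OF backlog_integrable])
    fix t
    have "s * (real N / real (Suc N)) * sum w (A t) \<le> (\<Sum>j\<in>A t. \<nu> t j * sum w (ahead (S t) (A t) j))"
      by (rule sum_share_total_at)
    also have "\<dots> = (\<Sum>j\<in>jobs I. charge j t)"
      using finite_jobs by (intro sum.mono_neutral_cong_left) (auto simp: charge_def live_def)
    finally show "s * (real N / real (Suc N)) * sum w (A t) \<le> (\<Sum>j\<in>jobs I. charge j t)" .
  qed
  also have "\<dots> = (\<Sum>j\<in>jobs I. integral {a..T} (charge j))"
    by (rule integral_sum) (auto simp: finite_jobs charge_integrable)
  finally show ?thesis .
qed

text \<open>\<open>integral {a..T} (charge j)\<close> is the dual variable of job \<open>j\<close>, and the load of a
  machine is the dual variable of that machine at time \<open>t\<close>. The equilibrium condition is the dual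
  constraint.\<close>

lemma dual_constraint:
  assumes \<tau>: "feasible 1 I \<tau>" and c: "\<And>j. j \<in> jobs I \<Longrightarrow> completion I \<tau> j = ereal (c j)"
    and a: "\<And>j. j \<in> jobs I \<Longrightarrow> a \<le> release I j"
  shows "(\<Sum>j\<in>jobs I. (integral {a..T} (charge j) - s * real N * w j * (c j - release I j)) / len I j
        * proc_rate I \<tau> j t)
    \<le> (1 + d) * ((if t \<in> {..T} then sum w (A t) else 0)
        + (\<Sum>j\<in>jobs I. if release I j \<le> t \<and> t < c j then w j else 0))"
proof -
  define y where "y j = share_of \<tau> j t" for j
  \<comment> \<open>The machine's dual variable, cut off after the horizon; \<open>k j\<close> is
    its value on the machine where \<tau> runs \<open>j\<close>.\<close>
  define B where "B i = (if t \<le> T then load w (S t) (A t) i else 0)" for i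
  define k where "k j = (case machine_of \<tau> j t of None \<Rightarrow> 0 | Some i \<Rightarrow> B i)" for j
  have w: "0 < w j" if "j \<in> jobs I" for j using that valid by (simp add: valid_instance_def)
  have B: "0 \<le> B i" for i
    unfolding B_def load_def using live(2) by (auto intro!: sum_nonneg intro: less_imp_le)
  have y0: "0 \<le> y j" for j
    unfolding y_def share_of_def using \<tau> by (auto simp: feasible_def split: option.split)
  have cap: "(\<Sum>j | j \<in> jobs I \<and> machine_of \<tau> j t = Some i. y j) \<le> 1" if "i < m" for i
    using \<tau> that unfolding feasible_def y_def by blast
  have job_bound: "(integral {a..T} (charge j) - s * real N * w j * (c j - release I j)) / len I j
        * proc_rate I \<tau> j t
      \<le> (1 + d) * (k j * y j) + (1 + d) * (if release I j \<le> t \<and> t < c j then w j else 0)"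
    if j: "j \<in> jobs I" for j
  proof (cases "\<tau> t j")
    case None
    then show ?thesis using w[OF j] d by (simp add: proc_rate_def y_def share_of_def)
  next
    case (Some p)
    obtain i x where p: "p = (i, x)" by (cases p)
    with Some have ix: "\<tau> t j = Some (i, x)" by simp
    then have *: "alive I \<tau> j t" "i < m" "0 \<le> x" using \<tau> by (auto simp: feasible_def)
    then have t: "release I j \<le> t" "t < c j" using c[OF j] by (auto simp: alive_def)
    have yx: "y j = x" and kB: "k j = B i"
      using ix by (auto simp: y_def share_of_def k_def machine_of_def)
    have x1: "x \<le> 1"
    proof -
      have "y j \<le> (\<Sum>j | j \<in> jobs I \<and> machine_of \<tau> j t = Some i. y j)"
        using finite_jobs j ix y0 by (intro member_le_sum) (auto simp: machine_of_def)
      then show ?thesis using cap[OF *(2)] yx by linarith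
    qed
    have len: "0 < len I j" using j by (rule len_pos)
    have rate: "0 \<le> rate I i j" using valid j *(2) by (simp add: valid_instance_def)
    have pr: "proc_rate I \<tau> j t = rate I i j * x" using ix by (simp add: proc_rate_def)
    let ?V = "if t \<le> T \<and> j \<in> A t then U t j else 0"
    \<comment> \<open>As \<tau> runs \<open>j\<close> at \<open>t\<close>, this time lies before
      \<open>c j\<close>, so the subtracted term absorbs the charge accrued up to
      \<open>t\<close>.\<close>
    have "s * real N * w j * (t - release I j) \<le> s * real N * w j * (c j - release I j)"
      using s w[OF j] t by (intro mult_left_mono) auto
    then have "integral {a..T} (charge j) - s * real N * w j * (c j - release I j) \<le> ?V * len I j"
      using total_charge_le[OF j a[OF j] t(1), of T] by (auto split: if_splits)
    then have "(integral {a..T} (charge j) - s * real N * w j * (c j - release I j)) / len I j \<le> ?V"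
      using len by (simp add: divide_le_eq)
    then have "(integral {a..T} (charge j) - s * real N * w j * (c j - release I j)) / len I j
        * proc_rate I \<tau> j t \<le> ?V * (rate I i j * x)"
      unfolding pr using rate *(3) by (intro mult_right_mono) auto
    also have "\<dots> = (?V * rate I i j) * x" by simp
    also have "\<dots> \<le> ((1 + d) * (B i + w j)) * x"
    proof (intro mult_right_mono *(3))
      show "?V * rate I i j \<le> (1 + d) * (B i + w j)"
      proof (cases "t \<le> T \<and> j \<in> A t \<and> 0 < rate I i j")
        case True
        then have "U t j \<le> (1 + d) * (load w (S t) (A t) i + w j) / l i j"
          using *(2) by (intro equilibrium) (auto simp: masked_rate_def)
        then show ?thesis using True *(2) by (simp add: masked_rate_def B_def field_simps)
      next
        case False
        then have "?V * rate I i j = 0" using rate by auto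
        moreover have "0 \<le> (1 + d) * (B i + w j)" using d B[of i] w[OF j] by simp
        ultimately show ?thesis by linarith
      qed
    qed
    also have "\<dots> = (1 + d) * (B i * x) + (1 + d) * (w j * x)" by (simp add: algebra_simps)
    also have "(1 + d) * (w j * x) \<le> (1 + d) * (w j * 1)"
      using d w[OF j] x1 by (intro mult_left_mono) auto
    finally show ?thesis using t yx kB by simp
  qed
  \<comment> \<open>Jobs are grouped by the machine on which \<tau> runs them; the unit capacity
    then leaves at most the sum of the loads.\<close>
  have "(\<Sum>j\<in>jobs I. k j * y j) = (\<Sum>j | j \<in> jobs I \<and> machine_of \<tau> j t \<noteq> None. k j * y j)"
    using finite_jobs by (intro sum.mono_neutral_right) (auto simp: k_def)
  also have "\<dots> = (\<Sum>i<m. \<Sum>j | j \<in> {j \<in> jobs I. machine_of \<tau> j t \<noteq> None} \<and> the (machine_of \<tau> j t) = i. k j * y j)"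
    using finite_jobs \<tau>
    by (intro sum.group[symmetric]) (auto simp: machine_of_def feasible_def)
  also have "\<dots> = (\<Sum>i<m. B i * (\<Sum>j | j \<in> jobs I \<and> machine_of \<tau> j t = Some i. y j))"
    unfolding sum_distrib_left by (intro sum.cong refl) (auto simp: k_def)
  also have "\<dots> \<le> (\<Sum>i<m. B i * 1)"
    using cap B by (intro sum_mono mult_left_mono) auto
  also have "\<dots> = (if t \<in> {..T} then sum w (A t) else 0)"
  proof -
    have "(\<Sum>i<m. load w (S t) (A t) i) = sum w (A t)"
      unfolding load_def using live(1) machine_lt by (intro sum.group) auto
    then show ?thesis by (simp add: B_def)
  qed
  finally have ky: "(1 + d) * (\<Sum>j\<in>jobs I. k j * y j) \<le> (1 + d) * (if t \<in> {..T} then sum w (A t) else 0)"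
    using d by (intro mult_left_mono) auto
  have "(\<Sum>j\<in>jobs I. (integral {a..T} (charge j) - s * real N * w j * (c j - release I j)) / len I j
        * proc_rate I \<tau> j t)
      \<le> (\<Sum>j\<in>jobs I. (1 + d) * (k j * y j) + (1 + d) * (if release I j \<le> t \<and> t < c j then w j else 0))"
    by (intro sum_mono job_bound)
  also have "\<dots> = (1 + d) * (\<Sum>j\<in>jobs I. k j * y j)
      + (1 + d) * (\<Sum>j\<in>jobs I. if release I j \<le> t \<and> t < c j then w j else 0)"
    by (simp only: sum.distrib sum_distrib_left)
  finally show ?thesis using ky by (simp add: distrib_left)
qed

text \<open>Weak duality: \<open>dual_constraint\<close> is integrated over time. As \<tau>
  processes each job for exactly its length, the division by \<open>len I j\<close> cancels, and
  \<open>backlog_le_charges\<close> bounds the total charge from below.\<close>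

lemma backlog_bound:
  assumes \<tau>: "feasible 1 I \<tau>" and c: "\<And>j. j \<in> jobs I \<Longrightarrow> completion I \<tau> j = ereal (c j)"
    and a: "\<And>j. j \<in> jobs I \<Longrightarrow> a \<le> release I j"
  shows "(s * (real N / real (Suc N)) - (1 + d)) * integral {a..T} (\<lambda>t. sum w (A t))
    \<le> (s * real N + 1 + d) * (\<Sum>j\<in>jobs I. w j * (c j - release I j))"
proof -
  \<comment> \<open>The end of the integration covers both the horizon and all completions of
    \<tau>.\<close>
  define b where "b = Max (insert T (c ` jobs I))"
  have b: "T \<le> b" "\<And>j. j \<in> jobs I \<Longrightarrow> c j \<le> b"
    unfolding b_def using finite_jobs by (auto intro!: Max_ge)
  have rc: "release I j \<le> c j" if "j \<in> jobs I" for j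
    using release_le_completion[of I j \<tau>] c[OF that] by simp
  let ?W = "integral {a..T} (\<lambda>t. sum w (A t))"
  let ?F = "\<Sum>j\<in>jobs I. w j * (c j - release I j)"
  let ?x = "\<lambda>j. integral {a..T} (charge j) - s * real N * w j * (c j - release I j)"
  have "(\<lambda>t. if t \<in> {..T} then sum w (A t) else 0) integrable_on {a..b}"
    "integral {a..b} (\<lambda>t. if t \<in> {..T} then sum w (A t) else 0) = ?W"
  proof -
    have "{..T} \<inter> {a..b} = {a..T}" using b(1) by auto
    then show "(\<lambda>t. if t \<in> {..T} then sum w (A t) else 0) integrable_on {a..b}"
      "integral {a..b} (\<lambda>t. if t \<in> {..T} then sum w (A t) else 0) = ?W"
      unfolding integrable_restrict_Int integral_restrict_Int using b(1) by (simp_all add: backlog_integrable min_absorb1)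
  qed
  then have "((\<lambda>t. if t \<in> {..T} then sum w (A t) else 0) has_integral ?W) {a..b}"
    using has_integral_integral by metis
  moreover have "((\<lambda>t. \<Sum>j\<in>jobs I. if release I j \<le> t \<and> t < c j then w j else 0) has_integral ?F) {a..b}"
    by (intro has_integral_sum finite_jobs has_integral_window a rc b(2))
  ultimately have R: "((\<lambda>t. (1 + d) * ((if t \<in> {..T} then sum w (A t) else 0)
        + (\<Sum>j\<in>jobs I. if release I j \<le> t \<and> t < c j then w j else 0)))
      has_integral (1 + d) * (?W + ?F)) {a..b}"
    by (intro has_integral_mult_right has_integral_add)
  have "((\<lambda>t. \<Sum>j\<in>jobs I. ?x j / len I j * proc_rate I \<tau> j t) has_integral
      (\<Sum>j\<in>jobs I. ?x j / len I j * len I j)) {a..b}"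
  proof (intro has_integral_sum finite_jobs has_integral_mult_right)
    fix j assume j: "j \<in> jobs I"
    show "(proc_rate I \<tau> j has_integral len I j) {a..b}"
      using feasible_processed(2)[OF valid \<tau> j c[OF j] a[OF j] b(2)[OF j]]
        feasible_proc_rate(1)[OF valid \<tau> j, of a b] has_integral_integral by metis
  qed
  also have "(\<Sum>j\<in>jobs I. ?x j / len I j * len I j) = (\<Sum>j\<in>jobs I. ?x j)"
    using len_pos by (intro sum.cong refl) force
  also have "\<dots> = (\<Sum>j\<in>jobs I. integral {a..T} (charge j)) - s * real N * ?F"
    by (simp add: sum_subtractf sum_distrib_left mult.assoc)
  finally have "(\<Sum>j\<in>jobs I. integral {a..T} (charge j)) - s * real N * ?F \<le> (1 + d) * (?W + ?F)"
    using R by (rule has_integral_le) (rule dual_constraint[OF \<tau> c a])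
  then show ?thesis using backlog_le_charges[of a T] by (simp add: algebra_simps)
qed

end

lemma cost_finite:
  assumes "\<And>j. j \<in> jobs I \<Longrightarrow> completion I \<tau> j = ereal (c j)"
  shows "cost I \<tau> = ereal (\<Sum>j\<in>jobs I. weight I j * (c j - release I j))"
  unfolding cost_def flow_time_def using assms by simp

lemma cost_infinite:
  assumes "valid_instance I" "j \<in> jobs I" "completion I \<tau> j = \<infinity>"
  shows "cost I \<tau> = \<infinity>"
proof -
  have "0 < weight I j" using assms by (simp add: valid_instance_def)
  then have "ereal (weight I j) * flow_time I \<tau> j = \<infinity>"
    using assms by (simp add: flow_time_def)
  then show ?thesis
    unfolding cost_def sum_Pinfty using assms by (auto simp: valid_instance_def)
qed

context online_run
begin

text \<open>The points \<open>x j\<close> allow infinite completion times, which are excluded only in the next lemma.\<close>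

lemma backlog_ge_window:
  assumes x: "\<And>j. j \<in> jobs I \<Longrightarrow> release I j \<le> x j \<and> ereal (x j) \<le> C j"
    and good: "\<And>j. j \<in> jobs I \<Longrightarrow> \<exists>i<m. 0 < rate I i j"
    and aT: "\<And>j. j \<in> jobs I \<Longrightarrow> a \<le> release I j" "\<And>j. j \<in> jobs I \<Longrightarrow> x j \<le> T"
  shows "(\<Sum>j\<in>jobs I. w j * (x j - release I j)) \<le> integral {a..T} (\<lambda>t. sum w (A t))"
proof (rule has_integral_le)
  show "((\<lambda>t. \<Sum>j\<in>jobs I. if release I j \<le> t \<and> t < x j then w j else 0) has_integral
      (\<Sum>j\<in>jobs I. w j * (x j - release I j))) {a..T}"
    using x aT by (intro has_integral_sum finite_jobs has_integral_window) auto
  show "((\<lambda>t. sum w (A t)) has_integral integral {a..T} (\<lambda>t. sum w (A t))) {a..T}"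
    using backlog_integrable has_integral_integral by blast
  fix t
  have "(\<Sum>j\<in>jobs I. if release I j \<le> t \<and> t < x j then w j else 0)
      = sum w {j \<in> jobs I. release I j \<le> t \<and> t < x j}"
    using finite_jobs by (simp add: sum.inter_filter)
  also have "\<dots> \<le> sum w (A t)"
  proof (intro sum_mono2 live(1))
    show "{j \<in> jobs I. release I j \<le> t \<and> t < x j} \<subseteq> A t"
    proof
      fix j assume j: "j \<in> {j \<in> jobs I. release I j \<le> t \<and> t < x j}"
      then have "ereal t < C j" using x[of j] less_le_trans[of "ereal t" "ereal (x j)" "C j"] by auto
      then show "j \<in> A t" using j good by (auto simp: live_def)
    qed
    show "0 \<le> w j" if "j \<in> A t - {j \<in> jobs I. release I j \<le> t \<and> t < x j}" for j
      using live(2)[of j t] that by auto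
  qed
  finally show "(\<Sum>j\<in>jobs I. if release I j \<le> t \<and> t < x j then w j else 0) \<le> sum w (A t)" .
qed

lemma cost_le:
  assumes \<tau>: "feasible 1 I \<tau>" and gap: "0 < s * (real N / real (Suc N)) - (1 + d)"
    and K: "s * real N + 1 + d \<le> K * (s * (real N / real (Suc N)) - (1 + d))"
  shows "cost I \<sigma> \<le> ereal K * cost I \<tau>"
proof -
  let ?g = "s * (real N / real (Suc N)) - (1 + d)"
  have "0 < s * real N + 1 + d" using s N d by (simp add: add_nonneg_pos add_pos_nonneg)
  then have "0 < K * ?g" using K by linarith
  then have Kpos: "0 < K" using gap zero_less_mult_pos2 by blast
  show ?thesis
  proof (cases "\<exists>j\<in>jobs I. completion I \<tau> j = \<infinity>")
    case True
    then have "cost I \<tau> = \<infinity>" using cost_infinite[OF valid] by blast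
    then show ?thesis using Kpos by simp
  next
    case False
    define c where "c j = real_of_ereal (completion I \<tau> j)" for j
    have c: "completion I \<tau> j = ereal (c j)" if "j \<in> jobs I" for j
      using False that release_le_completion[of I j \<tau>] unfolding c_def
      by (cases "completion I \<tau> j") auto
    \<comment> \<open>Since \<tau> completes all jobs, none of them is ignored by the algorithm, and
      the backlog counts every unfinished job.\<close>
    have good: "\<exists>i<m. 0 < rate I i j" if j: "j \<in> jobs I" for j
    proof (rule ccontr)
      assume no: "\<not> (\<exists>i<m. 0 < rate I i j)"
      have "proc_rate I \<tau> j t = 0" for t
      proof (cases "\<tau> t j")
        case (Some p)
        then have "fst p < m" using \<tau> by (cases p) (auto simp: feasible_def)
        then have "rate I (fst p) j = 0" using no valid j by (force simp: valid_instance_def)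
        then show ?thesis using Some by (cases p) (simp add: proc_rate_def)
      qed (simp add: proc_rate_def)
      then have "proc_rate I \<tau> j = (\<lambda>_. 0)" by auto
      then show False
        using feasible_processed(2)[OF valid \<tau> j c[OF j] order_refl order_refl] len_pos[OF j] by simp
    qed
    define a where "a = Min (release I ` jobs I)"
    have a: "a \<le> release I j" if "j \<in> jobs I" for j
      unfolding a_def using finite_jobs that by auto
    let ?F = "\<Sum>j\<in>jobs I. w j * (c j - release I j)"
    have F: "0 \<le> ?F"
    proof (intro sum_nonneg mult_nonneg_nonneg)
      fix j assume j: "j \<in> jobs I"
      then show "0 \<le> w j" using valid by (auto simp: valid_instance_def less_imp_le)
      show "0 \<le> c j - release I j" using release_le_completion[of I j \<tau>] c[OF j] by simp
    qed
    \<comment> \<open>The bound does not depend on the horizon. It is used first to show that all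
      completion times are finite, then at these times themselves.\<close>
    have win: "(\<Sum>j\<in>jobs I. w j * (x j - release I j)) \<le> K * ?F"
      if x: "\<And>j. j \<in> jobs I \<Longrightarrow> release I j \<le> x j \<and> ereal (x j) \<le> C j" for x
    proof -
      define T where "T = Max (x ` jobs I)"
      have T: "x j \<le> T" if "j \<in> jobs I" for j unfolding T_def using finite_jobs that by auto
      let ?W = "integral {a..T} (\<lambda>t. sum w (A t))"
      have "?g * ?W \<le> (s * real N + 1 + d) * ?F" by (rule backlog_bound[OF \<tau> c a])
      also have "\<dots> \<le> (K * ?g) * ?F" using K F by (intro mult_right_mono)
      finally have "?g * ?W \<le> ?g * (K * ?F)" by (simp add: mult_ac)
      then have "?W \<le> K * ?F" using gap by (simp only: mult_le_cancel_left_pos)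
      then show ?thesis using backlog_ge_window[OF x good a T] by linarith
    qed
    have fin: "C j \<noteq> \<infinity>" if j: "j \<in> jobs I" for j
    proof
      assume inf: "C j = \<infinity>"
      have wj: "0 < w j" using valid j by (simp add: valid_instance_def)
      \<comment> \<open>Chosen so that waiting for \<open>v\<close> would alone cost
        \<open>K * ?F + 1\<close>, more than \<open>win\<close> permits.\<close>
      define v where "v = (K * ?F + 1) / w j"
      have v: "0 \<le> v" unfolding v_def using Kpos F wj by simp
      define x where "x k = (if k = j then release I j + v else release I k)" for k
      have "(\<Sum>k\<in>jobs I. w k * (x k - release I k)) \<le> K * ?F"
        using C inf v by (intro win) (auto simp: x_def)
      also have "(\<Sum>k\<in>jobs I. w k * (x k - release I k)) = (\<Sum>k\<in>jobs I. if k = j then w j * v else 0)"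
        by (intro sum.cong) (auto simp: x_def)
      also have "\<dots> = K * ?F + 1" using finite_jobs j wj by (simp add: v_def)
      finally show False by simp
    qed
    define x where "x j = real_of_ereal (C j)" for j
    have x: "C j = ereal (x j)" if "j \<in> jobs I" for j
      using fin[OF that] C[OF that] unfolding x_def by (cases "C j") auto
    have "cost I \<sigma> = ereal (\<Sum>j\<in>jobs I. w j * (x j - release I j))"
      using completion_eq x by (intro cost_finite) auto
    also have "\<dots> \<le> ereal (K * ?F)"
      unfolding ereal_less_eq(3) using C x by (intro win) force
    also have "\<dots> = ereal K * cost I \<tau>" using cost_finite[of I \<tau> c] c by simp
    finally show ?thesis .
  qed
qed

lemma cost_le_opt:
  assumes gap: "0 < s * (real N / real (Suc N)) - (1 + d)"
    and K: "s * real N + 1 + d \<le> K * (s * (real N / real (Suc N)) - (1 + d))" and "0 < K"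
  shows "cost I \<sigma> \<le> ereal K * opt I"
proof -
  have "cost I \<sigma> / ereal K \<le> opt I"
    unfolding opt_def
    by (intro INF_greatest) (use cost_le[OF _ gap K] \<open>0 < K\<close> in \<open>auto simp: ereal_divide_le_pos\<close>)
  then show ?thesis using \<open>0 < K\<close> by (simp add: ereal_divide_le_pos)
qed

section \<open>Migrations\<close>

lemma machine_of_sched: "machine_of \<sigma> j t = (if j \<in> A t then Some (fst (S t j)) else None)"
  by (simp add: machine_of_def sched_def decide_def)

lemma migration_power:
  assumes mono: "strict_mono_on {..k} t" and on: "\<And>a. a \<le> k \<Longrightarrow> machine_of \<sigma> j (t a) \<noteq> None"
    and diff: "\<And>a. a < k \<Longrightarrow> machine_of \<sigma> j (t a) \<noteq> machine_of \<sigma> j (t (Suc a))" and "0 < k"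
  shows "(1 + d) ^ k * U (t k) j < U (t 0) j"
proof -
  have jA: "j \<in> A (t a)" if "a \<le> k" for a
    using on[OF that] by (auto simp: machine_of_sched split: if_splits)
  have step: "(1 + d) * U (t (Suc a)) j < U (t a) j" if "a < k" for a
  proof (rule U_mono(2))
    show "t a \<le> t (Suc a)"
      using strict_mono_onD[OF mono, of a "Suc a"] that by auto
    show "fst (S (t (Suc a)) j) \<noteq> fst (S (t a) j)"
      using diff[OF that] jA[of a] jA[of "Suc a"] that by (auto simp: machine_of_sched)
  qed (use jA that in auto)
  have "(1 + d) ^ Suc n * U (t (Suc n)) j < U (t 0) j" if "Suc n \<le> k" for n
    using that
  proof (induction n)
    case 0
    then show ?case using step[of 0] by simp
  next
    case (Suc n)
    have "(1 + d) ^ Suc (Suc n) * U (t (Suc (Suc n))) j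
        = (1 + d) ^ Suc n * ((1 + d) * U (t (Suc (Suc n))) j)" by simp
    also have "\<dots> \<le> (1 + d) ^ Suc n * U (t (Suc n)) j"
      using step[of "Suc n"] Suc.prems d by (intro mult_left_mono) auto
    also have "\<dots> < U (t 0) j" using Suc by simp
    finally show ?case .
  qed
  from this[of "k - 1"] show ?thesis using \<open>0 < k\<close> by simp
qed

text \<open>Here \<open>r\<close> is the largest rate of job \<open>j\<close>.\<close>

lemma delay_bounds:
  assumes j: "j \<in> A t" "j \<in> A t'"
  obtains r where "0 < r" "w j / r \<le> U t' j" "U t j \<le> (1 + d) * (sum w (jobs I) / r)"
proof
  define r where "r = Max ((\<lambda>i. l i j) ` {..<m})"
  have le: "l i j \<le> r" if "i < m" for i unfolding r_def using that by auto
  have "(\<lambda>i. l i j) ` {..<m} \<noteq> {}" using valid by (auto simp: valid_instance_def)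
  then have "r \<in> (\<lambda>i. l i j) ` {..<m}" unfolding r_def by (intro Max_in) auto
  then obtain i where i: "i < m" "r = l i j" by auto
  show r: "0 < r" using live(3)[OF j(1)] le by force
  have w0: "0 \<le> w k" if "k \<in> jobs I" for k using valid that by (auto simp: valid_instance_def less_imp_le)
  have AJ: "A t \<subseteq> jobs I" for t by (auto simp: live_def)
  show "w j / r \<le> U t' j"
    unfolding delay_def using ahead_bounds_at(1)[OF j(2)] le[OF machine_lt[OF j(2)]] rate_pos[OF j(2)] live(2)[OF j(2)]
    by (intro frac_le) auto
  \<comment> \<open>On the fastest machine \<open>i\<close> the position is at most the load.
    Elsewhere the equilibrium condition is applied to \<open>i\<close>, whose load does not contain
    \<open>j\<close>, so that adding \<open>w j\<close> stays within the total weight.\<close>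
  show "U t j \<le> (1 + d) * (sum w (jobs I) / r)"
  proof (cases "fst (S t j) = i")
    case True
    have "load w (S t) (A t) i \<le> sum w (jobs I)"
      unfolding load_def using AJ w0 finite_jobs by (intro sum_mono2) auto
    then have "U t j \<le> sum w (jobs I) / r"
      using ahead_bounds_at(2)[OF j(1)] True i r by (simp add: delay_def divide_right_mono)
    also have "\<dots> \<le> (1 + d) * (sum w (jobs I) / r)"
      using mult_right_mono[of 1 "1 + d" "sum w (jobs I) / r"] d r w0 by (simp add: sum_nonneg)
    finally show ?thesis .
  next
    case False
    have "load w (S t) (A t) i + w j = sum w (insert j {k \<in> A t. fst (S t k) = i})"
      unfolding load_def using False live(1) by simp
    also have "\<dots> \<le> sum w (jobs I)"
      using AJ j w0 finite_jobs by (intro sum_mono2) auto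
    finally have "(1 + d) * (load w (S t) (A t) i + w j) / l i j \<le> (1 + d) * sum w (jobs I) / r"
      unfolding i(2)[symmetric] using r d by (intro divide_right_mono mult_left_mono) auto
    then show ?thesis using equilibrium[OF j(1) i(1)] r i by simp
  qed
qed

text \<open>By \<open>migration_power\<close> and \<open>delay_bounds\<close>, \<open>k\<close>
  migrations force \<open>(1 + d) ^ k\<close> below \<open>(1 + d)\<close> times the total weight
  divided by \<open>w j\<close>; logarithms are then taken.\<close>

lemma migrations_le:
  assumes j: "j \<in> jobs I" and d1: "0 < d" "d \<le> 1 / 2"
  shows "ereal_of_enat (migrations \<sigma> j)
    \<le> ereal (4 / d * (ln (weight_ratio I) + ln (real (num_jobs I))))"
proof -
  define n where "n = num_jobs I"
  define W where "W = weight_ratio I"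
  have w: "0 < w k" if "k \<in> jobs I" for k using valid that by (auto simp: valid_instance_def)
  let ?mx = "Max (w ` jobs I)" and ?mn = "Min (w ` jobs I)"
  have ne: "w ` jobs I \<noteq> {}" using j by auto
  have mx: "w k \<le> ?mx" and mn: "?mn \<le> w k" if "k \<in> jobs I" for k using finite_jobs that by auto
  have mn0: "0 < ?mn" using w ne finite_jobs by (subst Min_gr_iff) auto
  have W1: "1 \<le> W" unfolding W_def weight_ratio_def using mx[OF j] mn[OF j] mn0 by simp
  have n1: "1 \<le> n" unfolding n_def num_jobs_def using card_gt_0_iff[of "jobs I"] finite_jobs j by auto
  have tot: "sum w (jobs I) \<le> real n * W * w j"
  proof -
    have "sum w (jobs I) \<le> (\<Sum>k\<in>jobs I. ?mx)" by (intro sum_mono mx)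
    also have "\<dots> = real n * ?mx" by (simp add: n_def num_jobs_def)
    also have "\<dots> = real n * W * ?mn" using mn0 by (simp add: W_def weight_ratio_def)
    also have "\<dots> \<le> real n * W * w j" using mn[OF j] W1 by (intro mult_left_mono) auto
    finally show ?thesis .
  qed
  have main: "real k \<le> 4 / d * (ln W + ln (real n))"
    if mono: "strict_mono_on {..k} t" and on: "\<forall>a\<le>k. machine_of \<sigma> j (t a) \<noteq> None"
      and diff: "\<forall>a<k. machine_of \<sigma> j (t a) \<noteq> machine_of \<sigma> j (t (Suc a))" for k t
  proof (cases "k = 0")
    case True
    have "0 \<le> ln W + ln (real n)" using W1 n1 by (intro add_nonneg_nonneg ln_ge_zero) auto
    then show ?thesis using True d1 by simp
  next
    case False
    have jA: "j \<in> A (t a)" if "a \<le> k" for a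
      using on that by (force simp: machine_of_sched split: if_splits)
    obtain r where r: "0 < r" "w j / r \<le> U (t k) j" "U (t 0) j \<le> (1 + d) * (sum w (jobs I) / r)"
      using delay_bounds[OF jA[of 0] jA[of k]] by auto
    have "(1 + d) ^ k * (w j / r) \<le> (1 + d) ^ k * U (t k) j"
      using r(2) d by (intro mult_left_mono) auto
    also have "\<dots> < U (t 0) j"
      using mono on diff False by (intro migration_power) auto
    also note r(3)
    also have "(1 + d) * (sum w (jobs I) / r) \<le> (1 + d) * ((real n * W * w j) / r)"
      using tot r(1) d by (intro mult_left_mono divide_right_mono) auto
    finally have "(1 + d) ^ k * (w j / r) < (1 + d) * (real n * W) * (w j / r)" by (simp add: mult_ac)
    then have lt: "(1 + d) ^ k < (1 + d) * (real n * W)"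
      using w[OF j] r(1) by (simp only: mult_less_cancel_right_pos divide_pos_pos)
    \<comment> \<open>A lone job never migrates. With two jobs, \<open>real n * W\<close> is at
      least 2 and absorbs the leading factor \<open>1 + d\<close>, at the price of a square.\<close>
    have n2: "2 \<le> n"
    proof (rule ccontr)
      assume "\<not> 2 \<le> n"
      then have "n = 1" using n1 by simp
      then have "card (jobs I) = 1" by (simp add: n_def num_jobs_def)
      then have "jobs I = {j}" using j by (auto simp: card_1_singleton_iff)
      then have "W = 1" using w[OF j] by (simp add: W_def weight_ratio_def)
      then have "(1 + d) ^ k < (1 + d) ^ 1" using lt \<open>n = 1\<close> by simp
      moreover have "(1 + d) ^ 1 \<le> (1 + d) ^ k" using False d by (intro power_increasing) auto
      ultimately show False by simp
    qed
    have nW: "2 \<le> real n * W" using mult_mono[of 2 "real n" 1 W] n2 W1 by simp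
    then have "(1 + d) * (real n * W) \<le> (real n * W) * (real n * W)"
      using d1 by (intro mult_right_mono) auto
    then have "(1 + d) ^ k < (real n * W)\<^sup>2" using lt by (simp add: power2_eq_square)
    then have "ln ((1 + d) ^ k) < ln ((real n * W)\<^sup>2)" using d1 nW n1 by (subst ln_less_cancel_iff) auto
    then have k: "real k * ln (1 + d) < 2 * ln (real n * W)"
      using d1 nW by (simp add: ln_realpow)
    \<comment> \<open>This makes \<open>d - d * d\<close>, the lower bound for the logarithm of
      \<open>1 + d\<close>, at least \<open>d / 2\<close>; together with the square it yields the
      constant 4.\<close>
    have "d\<^sup>2 \<le> d / 2" using mult_left_mono[OF d1(2), of d] d1(1) by (simp add: power2_eq_square)
    then have "d / 2 \<le> ln (1 + d)"
      using ln_one_plus_pos_lower_bound[of d] d1 by linarith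
    then have "real k * (d / 2) \<le> real k * ln (1 + d)" by (intro mult_left_mono) auto
    then have "real k * (d / 2) \<le> 2 * ln (real n * W)" using k by linarith
    then have "real k \<le> 4 / d * ln (real n * W)" using d1 by (simp add: field_simps)
    then show ?thesis using W1 n1 by (simp add: ln_mult add.commute)
  qed
  have "migrations \<sigma> j \<le> enat (nat \<lfloor>4 / d * (ln W + ln (real n))\<rfloor>)"
    unfolding migrations_def
    by (intro SUP_least) (use main in \<open>auto simp: le_nat_floor\<close>)
  then have "ereal_of_enat (migrations \<sigma> j) \<le> ereal_of_enat (enat (nat \<lfloor>4 / d * (ln W + ln (real n))\<rfloor>))"
    by (simp only: ereal_of_enat_le_iff)
  also have "\<dots> \<le> ereal (4 / d * (ln W + ln (real n)))"
    using W1 n1 d1 by (simp add: of_nat_floor add_nonneg_nonneg)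
  finally show ?thesis by (simp add: W_def n_def)
qed

end

section \<open>Choice of the parameters\<close>

lemma feasible_mono: "feasible s I \<tau> \<Longrightarrow> s \<le> s' \<Longrightarrow> feasible s' I \<tau>"
  unfolding feasible_def by (meson order_trans)

theorem theorem1:
  shows "\<exists>c K :: real \<Rightarrow> real.
    c \<in> O[at_right 0](\<lambda>\<epsilon>. 1 / \<epsilon>\<^sup>2) \<and>
    K \<in> O[at_right 0](\<lambda>\<epsilon>. 1 / \<epsilon>) \<and>
    (\<forall>\<epsilon>>0. \<exists>A.
       speed_competitive (1 + \<epsilon>) (c \<epsilon>) A \<and>
       (\<forall>I \<sigma>. valid_instance I \<and> generates A I \<sigma> \<longrightarrow>
          (\<forall>j\<in>jobs I. ereal_of_enat (migrations \<sigma> j)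
             \<le> ereal (K \<epsilon> * (ln (weight_ratio I) + ln (real (num_jobs I)))))))"
proof (rule exI[of _ "\<lambda>\<epsilon>. 48 / (min \<epsilon> 1)\<^sup>2"], rule exI[of _ "\<lambda>\<epsilon>. 16 / min \<epsilon> 1"],
    intro conjI allI impI)
  let ?c = "\<lambda>\<epsilon>::real. 48 / (min \<epsilon> 1)\<^sup>2" and ?K = "\<lambda>\<epsilon>::real. 16 / min \<epsilon> 1"
  have ev: "eventually (\<lambda>\<epsilon>::real. 0 < \<epsilon> \<and> \<epsilon> < 1) (at_right 0)"
    by (rule eventually_at_rightI[of 0 1]) auto
  show "?c \<in> O[at_right 0](\<lambda>\<epsilon>. 1 / \<epsilon>\<^sup>2)"
    by (rule bigoI[of _ 48]) (rule eventually_mono[OF ev], simp)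
  show "?K \<in> O[at_right 0](\<lambda>\<epsilon>. 1 / \<epsilon>)"
    by (rule bigoI[of _ 16]) (rule eventually_mono[OF ev], simp)
  fix \<epsilon> :: real assume \<epsilon>: "0 < \<epsilon>"
  \<comment> \<open>For large \<epsilon> the algorithm uses only speed 2, which is feasible at the
    higher speed by \<open>feasible_mono\<close>.\<close>
  define e where "e = min \<epsilon> 1"
  have e: "0 < e" "e \<le> 1" "e \<le> \<epsilon>" using \<epsilon> by (auto simp: e_def)
  \<comment> \<open>\<open>N / (N + 1)\<close> is at least \<open>1 - e / 4\<close>, so its product
    with \<open>s\<close> is at least \<open>1 + e / 2\<close>; subtracting \<open>1 + d\<close>
    leaves \<open>e / 4\<close>. The migration constant \<open>4 / d\<close> becomes
    \<open>16 / e\<close>.\<close>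
  define d where "d = e / 4"
  define s where "s = 1 + e"
  define N where "N = nat \<lceil>4 / e\<rceil>"
  have N1: "4 / e \<le> real N" unfolding N_def by linarith
  have N2: "real N \<le> 4 / e + 1" unfolding N_def using e by (simp add: of_nat_nat)
  have "0 < 4 / e" using e by simp
  then have N0: "0 < N" using N1 by (cases "N = 0") auto
  have par: "0 \<le> d" "0 \<le> s" "0 < d" "d \<le> 1 / 2" using e by (auto simp: d_def s_def)
  have "4 \<le> e * real N" using N1 e by (simp add: field_simps)
  then have "1 - e / 4 \<le> real N / real (Suc N)" using e by (simp add: field_simps)
  then have "s * (1 - e / 4) \<le> s * (real N / real (Suc N))" using par by (intro mult_left_mono)
  moreover have "e * e \<le> e" using mult_left_mono[of e 1 e] e by simp
  ultimately have gap: "e / 4 \<le> s * (real N / real (Suc N)) - (1 + d)"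
  proof -
    have "s * (1 - e / 4) = 1 + 3 * e / 4 - e * e / 4"
      unfolding s_def by (simp add: field_simps)
    then show ?thesis
      using \<open>s * (1 - e / 4) \<le> s * (real N / real (Suc N))\<close> \<open>e * e \<le> e\<close> unfolding d_def by linarith
  qed
  then have gap0: "0 < s * (real N / real (Suc N)) - (1 + d)" using e by linarith
  have c0: "0 < ?c \<epsilon>" using e by (simp add: e_def[symmetric])
  define u where "u = 1 / e"
  have u: "1 \<le> u" "4 / e = 4 * u" "12 / e = 12 * u" using e by (simp_all add: u_def)
  have "s * real N \<le> 2 * (4 * u + 1)"
    using N2 e unfolding u(2)[symmetric] by (intro mult_mono) (auto simp: s_def)
  moreover have "x + 1 + e / 4 \<le> 12 * u" if "x \<le> 2 * (4 * u + 1)" for x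
    using that u(1) e(2) by simp
  ultimately have "s * real N + 1 + d \<le> 12 / e"
    unfolding u(3) d_def by blast
  \<comment> \<open>The numerator bound \<open>12 / e\<close> divided by the gap
    \<open>e / 4\<close> gives the ratio \<open>48 / (e * e)\<close>.\<close>
  also have "\<dots> = ?c \<epsilon> * (e / 4)" using e by (simp add: e_def[symmetric] power2_eq_square)
  also have "\<dots> \<le> ?c \<epsilon> * (s * (real N / real (Suc N)) - (1 + d))"
    using gap c0 by (intro mult_left_mono) auto
  finally have cK: "s * real N + 1 + d \<le> ?c \<epsilon> * (s * (real N / real (Suc N)) - (1 + d))" .
  let ?A = "migrate_alg d s N"
  have online: "online_run d s N I (completion I \<sigma>)" and eq: "\<sigma> = sched d s N I (completion I \<sigma>)"
    if "valid_instance I" "generates ?A I \<sigma>" for I \<sigma>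
  proof -
    note g = generates_eq_sched[OF that(2) par(1,2) N0 that(1)]
    show "\<sigma> = sched d s N I (completion I \<sigma>)" by (rule g(2))
    show "online_run d s N I (completion I \<sigma>)"
      using g by (simp add: online_run_def online_run_axioms_def)
  qed
  show "\<exists>A. speed_competitive (1 + \<epsilon>) (?c \<epsilon>) A \<and>
       (\<forall>I \<sigma>. valid_instance I \<and> generates A I \<sigma> \<longrightarrow>
          (\<forall>j\<in>jobs I. ereal_of_enat (migrations \<sigma> j)
             \<le> ereal (?K \<epsilon> * (ln (weight_ratio I) + ln (real (num_jobs I))))))"
  proof (intro exI[of _ ?A] conjI allI impI ballI)
    show "speed_competitive (1 + \<epsilon>) (?c \<epsilon>) ?A"
      unfolding speed_competitive_def
    proof (intro allI impI conjI)
      fix I assume I: "valid_instance I"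
      show "\<exists>\<sigma>. generates ?A I \<sigma>" by (rule generates_exists[OF par(1,2) N0 I])
      fix \<sigma> assume g: "generates ?A I \<sigma>"
      note o = online[OF I g] and q = eq[OF I g]
      have "feasible s I \<sigma>" using online_run.feasible_sched[OF o] q by simp
      then show "feasible (1 + \<epsilon>) I \<sigma>" using e by (elim feasible_mono) (simp add: s_def)
      show "cost I \<sigma> \<le> ereal (?c \<epsilon>) * opt I"
        using online_run.cost_le_opt[OF o gap0 cK c0] q by simp
    qed
  next
    fix I \<sigma> j assume I: "valid_instance I \<and> generates ?A I \<sigma>" and j: "j \<in> jobs I"
    then have o: "online_run d s N I (completion I \<sigma>)" and q: "\<sigma> = sched d s N I (completion I \<sigma>)"
      using online eq by blast+
    show "ereal_of_enat (migrations \<sigma> j)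
        \<le> ereal (?K \<epsilon> * (ln (weight_ratio I) + ln (real (num_jobs I))))"
      using online_run.migrations_le[OF o j par(3,4)] q by (simp add: d_def e_def)
  qed
qed

end
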